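(* Let $n\ge1$. (1) The eigenvalues of the down-up walk on the $n$th level $DP(n)$ of the Schur lattice are parameterized by $\mu\in OP(n)$ and are $\frac{m_1(\mu)}{n}$, where $m_1(\mu)$ is the number of parts of $\mu$ of size $1$. (2) The functions $$\psi_\mu(\lambda)=\sqrt{\frac{n!}{z_\mu 2^{n-l(\mu)}}}\;\frac{X^\lambda_\mu}{g_\lambda}\qquad(\mu\in OP(n),\ \lambda\in DP(n))$$ are a corresponding basis of eigenvectors, orthonormal with respect to the inner product $$\langle f_1,f_2\rangle=\sum_{\lambda\in DP(n)}f_1(\lambda)\overline{f_2(\lambda)}\,\frac{2^{n-l(\lambda)}g_\lambda^2}{n!}.$$
   Context: $DP(n)$ is the set of partitions of $n$ into distinct parts, and $OP(n)$ the set of partitions of $n$ into odd parts. $l(\lambda)$ is the number of parts of $\lambda$. For $\lambda$ with distinct parts, $g_\lambda$ is the number of standard shifted tableaux of shape $\lambda$. $m_i(\mu)$ is the number of parts of $\mu$ of size $i$, and $z_\mu=\prod_i i^{m_i(\mu)}m_i(\mu)!$. $X^\lambda_\mu$ denotes the coefficient of the Hall–Littlewood polynomial $P_\lambda(x;-1)$ (i.e. $P_\lambda(x;t)$ at $t=-1$) in the expansion of the power sum symmetric function $p_\mu(x)$. Write $\tau\nearrow\lambda$ if $\tau,\lambda$ are partitions into distinct parts and the diagram of $\lambda$ is obtained from that of $\tau$ by adding one box. The down-up walk on $DP(n)$ is the Markov chain $K$ which moves from $\lambda$ to $\rho$ with probability $$K(\lambda,\rho)=\frac{2g_\rho}{n\,g_\lambda}\sum_{\tau\in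 DP(n-1),\ \tau\nearrow\lambda,\ \tau\nearrow\rho}2^{l(\tau)-l(\rho)}.$$ It acts on functions on $DP(n)$ by $Kf(\lambda)=\sum_\rho K(\lambda,\rho)f(\rho)$; "eigenvalues" and "eigenvectors" refer to this operator. *)

theory Defs
  imports Complex_Main "HOL-Library.FuncSet" "HOL-Library.Multiset" "HOL-Library.Function_Algebras"
begin

section \<open>Partitions\<close>

text \<open>A partition is the weakly decreasing list of its (positive) parts.\<close>

definition partitions :: "nat \<Rightarrow> nat list set" where
  "partitions n = {l. sorted_wrt (\<ge>) l \<and> 0 \<notin> set l \<and> sum_list l = n}"

definition DP :: "nat \<Rightarrow> nat list set" where
  "DP n = {l \<in> partitions n. distinct l}"

definition OP :: "nat \<Rightarrow> nat list set" where
  "OP n = {l \<in> partitions n. \<forall>k\<in>set l. odd k}"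

definition mult_part :: "nat \<Rightarrow> nat list \<Rightarrow> nat" where
  "mult_part i l = count (mset l) i"

definition z_part :: "nat list \<Rightarrow> nat" where
  "z_part l = (\<Prod>i\<in>set l. i ^ mult_part i l * fact (mult_part i l))"

section \<open>Standard shifted tableaux and the Schur lattice\<close>

text \<open>Boxes are pairs (row, column), counted from 0; row i is shifted i steps to the right.\<close>

definition shifted_diagram :: "nat list \<Rightarrow> (nat \<times> nat) set" where
  "shifted_diagram l = {(i, j). i < length l \<and> i \<le> j \<and> j < i + l ! i}"

text \<open>Fillings are \<^const>\<open>extensional\<close> so that distinct functions are distinct tableaux.\<close>

definition standard_shifted_tableaux :: "nat list \<Rightarrow> (nat \<times> nat \<Rightarrow> nat) set" where
  "standard_shifted_tableaux l =
     {T \<in> extensional (shifted_diagram l).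
        bij_betw T (shifted_diagram l) {1..sum_list l} \<and>
        (\<forall>i j j'. (i, j) \<in> shifted_diagram l \<longrightarrow> (i, j') \<in> shifted_diagram l \<longrightarrow> j < j'
            \<longrightarrow> T (i, j) < T (i, j')) \<and>
        (\<forall>i i' j. (i, j) \<in> shifted_diagram l \<longrightarrow> (i', j) \<in> shifted_diagram l \<longrightarrow> i < i'
            \<longrightarrow> T (i, j) < T (i', j))}"

definition g_num :: "nat list \<Rightarrow> nat" where
  "g_num l = card (standard_shifted_tableaux l)"

definition covers :: "nat list \<Rightarrow> nat list \<Rightarrow> bool" (infix "\<nearrow>" 50) where
  "t \<nearrow> l \<longleftrightarrow> (\<exists>m. t \<in> DP m) \<and> (\<exists>m. l \<in> DP m) \<and>
     (\<exists>b. b \<notin> shifted_diagram t \<and> shifted_diagram l = insert b (shifted_diagram t))"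

definition down_up :: "nat \<Rightarrow> nat list \<Rightarrow> nat list \<Rightarrow> real" where
  "down_up n l r = 2 * real (g_num r) / (real n * real (g_num l)) *
     (\<Sum>t \<in> {t \<in> DP (n - 1). t \<nearrow> l \<and> t \<nearrow> r}. 2 powi (int (length t) - int (length r)))"

section \<open>Hall--Littlewood polynomials\<close>

text \<open>
  The polynomial \<open>P\<^sub>l(x\<^sub>0, \<dots>, x\<^bsub>N-1\<^esub>; t)\<close>, as a function of pairwise distinct points, given by
  \<open>P\<^sub>l = \<Sum>\<^bsub>w \<in> S\<^sub>N / S\<^sub>N\<^sup>l\<^esub> w (x\<^sup>l \<Prod>\<^bsub>l\<^sub>i > l\<^sub>j\<^esub> (x\<^sub>i - t x\<^sub>j) / (x\<^sub>i - x\<^sub>j))\<close>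
  (Macdonald, Symmetric Functions and Hall Polynomials, III (2.2)). The cosets correspond to the
  distinct rearrangements \<open>a\<close> of \<open>l\<close> padded with zeros to length \<open>N\<close>; there are none if \<open>N\<close> is
  smaller than the number of parts, and then the value is 0. Unlike the sum over all of \<open>S\<^sub>N\<close>
  divided by its normalising polynomial in \<open>t\<close>, this form can be specialised directly to
  \<open>t = -1\<close>, where that normalising polynomial may vanish.

  For coinciding points the summands are not meaningful (division by zero), so the function is
  only to be used for \<open>x\<close> injective on \<open>{..<N}\<close>.
\<close>

definition hall_littlewood :: "nat \<Rightarrow> nat list \<Rightarrow> 'a::field \<Rightarrow> (nat \<Rightarrow> 'a) \<Rightarrow> 'a" where
  "hall_littlewood N l t x =
     (\<Sum>a \<in> {a :: nat list. length a = N \<and> filter_mset (\<lambda>k. k > 0) (mset a) = mset l}.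
        (\<Prod>i<N. x i ^ (a ! i)) *
        (\<Prod>(i, j) \<in> {(i, j). i < N \<and> j < N \<and> a ! i > a ! j}. (x i - t * x j) / (x i - x j)))"

definition power_sum :: "nat \<Rightarrow> nat list \<Rightarrow> (nat \<Rightarrow> 'a::field) \<Rightarrow> 'a" where
  "power_sum N m x = (\<Prod>k\<leftarrow>m. \<Sum>i<N. x i ^ k)"

text \<open>
  An identity of symmetric functions is an identity of symmetric polynomials in every number
  \<open>N\<close> of variables, and a polynomial identity over the reals is an identity of values at all
  points with pairwise distinct coordinates. As \<open>p\<^sub>m\<close> is homogeneous, only partitions
  of \<^term>\<open>sum_list m\<close> can occur in its expansion; all of them are allowed here,
  not only those with distinct parts.
\<close>

definition is_HL_expansion :: "nat list \<Rightarrow> (nat list \<Rightarrow> real) \<Rightarrow> bool" where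
  "is_HL_expansion m c \<longleftrightarrow>
     (\<forall>l. l \<notin> partitions (sum_list m) \<longrightarrow> c l = 0) \<and>
     (\<forall>N x. inj_on x {..<N} \<longrightarrow>
        power_sum N m x = (\<Sum>l \<in> partitions (sum_list m). c l * hall_littlewood N l (-1) x))"

definition X_coeff :: "nat list \<Rightarrow> nat list \<Rightarrow> real" where
  "X_coeff l m = (THE c. is_HL_expansion m c) l"

section \<open>Functions on \<open>DP n\<close>\<close>

definition fscale :: "complex \<Rightarrow> (nat list \<Rightarrow> complex) \<Rightarrow> nat list \<Rightarrow> complex" where
  "fscale c f = (\<lambda>l. c * f l)"

interpretation fn: vector_space fscale
  by unfold_locales (auto simp: fscale_def fun_eq_iff algebra_simps)

text \<open>Functions on \<^term>\<open>DP n\<close> are represented by their extensions by zero.\<close>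

definition fun_space :: "nat \<Rightarrow> (nat list \<Rightarrow> complex) set" where
  "fun_space n = {f. \<forall>l. l \<notin> DP n \<longrightarrow> f l = 0}"

definition K_op :: "nat \<Rightarrow> (nat list \<Rightarrow> complex) \<Rightarrow> nat list \<Rightarrow> complex" where
  "K_op n f = (\<lambda>l. if l \<in> DP n then \<Sum>r\<in>DP n. of_real (down_up n l r) * f r else 0)"

definition eigenspace :: "nat \<Rightarrow> complex \<Rightarrow> (nat list \<Rightarrow> complex) set" where
  "eigenspace n c = {f \<in> fun_space n. K_op n f = fscale c f}"

definition is_eigenvector :: "nat \<Rightarrow> complex \<Rightarrow> (nat list \<Rightarrow> complex) \<Rightarrow> bool" where
  "is_eigenvector n c f \<longleftrightarrow> f \<in> eigenspace n c \<and> f \<noteq> 0"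

definition is_eigenvalue :: "nat \<Rightarrow> complex \<Rightarrow> bool" where
  "is_eigenvalue n c \<longleftrightarrow> (\<exists>f. is_eigenvector n c f)"

definition inner_DP :: "nat \<Rightarrow> (nat list \<Rightarrow> complex) \<Rightarrow> (nat list \<Rightarrow> complex) \<Rightarrow> complex" where
  "inner_DP n f1 f2 =
     (\<Sum>l\<in>DP n. f1 l * cnj (f2 l) * of_real (2 ^ (n - length l) * real (g_num l) ^ 2 / fact n))"

definition psi :: "nat \<Rightarrow> nat list \<Rightarrow> nat list \<Rightarrow> complex" where
  "psi n m l = (if l \<in> DP n
     then of_real (sqrt (fact n / (real (z_part m) * 2 ^ (n - length m))) * (X_coeff l m / real (g_num l)))
     else 0)"

end

theory Submission
  imports Defs "HOL-Library.FSet" "HOL-Library.Nat_Bijection" "HOL-Computational_Algebra.Polynomial"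
begin

text \<open>
  At \<open>t = -1\<close> the functions \<open>P\<^sub>l\<close> of strict partitions \<open>l\<close> behave like the basis of a Fock space of
  neutral fermions \<open>\<phi>\<^sub>j\<close> (\<open>j\<close> an integer) with \<open>\<phi>\<^sub>i \<phi>\<^sub>j + \<phi>\<^sub>j \<phi>\<^sub>i = (-1)\<^sup>i / 2\<close> if \<open>i + j = 0\<close> and \<open>0\<close> otherwise.
  For odd \<open>r\<close> put \<open>H\<^sub>r\<close> (the operator \<open>boson r\<close>) \<open>= \<Sum>\<^sub>i (-1)\<^sup>i \<phi>\<^bsub>r-i\<^esub> \<phi>\<^sub>i\<close>. Then \<open>[H\<^sub>r, \<phi>\<^sub>j] = \<phi>\<^bsub>j+r\<^esub>\<close>, so \<open>[H\<^sub>s, H\<^sub>r]\<close> commutes with all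
  \<open>\<phi>\<^sub>j\<close> and is a scalar: \<open>r/2\<close> if \<open>s = -r < 0\<close>, and \<open>0\<close> if \<open>r + s \<noteq> 0\<close>. Moreover \<open>H\<^bsub>-r\<^esub>\<close> is adjoint to
  \<open>H\<^sub>r\<close> for the inner product that makes the \<open>P\<^sub>l\<close> orthogonal with squared length \<open>2\<close> to the power
  \<open>-length l\<close>.

  On actual functions, \<open>P\<^sub>l\<close> is obtained from \<open>1\<close> by operators that raise one variable to a power and
  anticommute, and multiplication by the power sum \<open>p\<^sub>r\<close>, \<open>r\<close> odd, corresponds to \<open>H\<^sub>r\<close>, \<open>r > 0\<close>. So the
  coefficients of \<open>p\<^sub>m\<close> are the coordinates of \<open>H\<close>-monomials applied to the vacuum, and their orthogonality
  follows from the commutation relations. Finally \<open>H\<^sub>1\<close> adds a box in all possible ways, its adjoint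
  \<open>H\<^bsub>-1\<^esub>\<close> removes one, and the down-up walk is conjugate to \<open>2/n\<close> times \<open>H\<^sub>1 H\<^bsub>-1\<^esub>\<close>; the latter multiplies the
  vector of \<open>p\<^sub>m\<close> by half the number of ones in \<open>m\<close>. Completeness is a count:
  Glaisher's map shows that there are at least as many partitions into odd parts as into distinct parts.
\<close>

section \<open>Neutral fermions\<close>

definition parity_sign :: "int \<Rightarrow> real" where
  "parity_sign a = (if even a then 1 else -1)"

definition toggle :: "'a \<Rightarrow> 'a fset \<Rightarrow> 'a fset" where
  "toggle k S = (if k |\<in>| S then S |-| {|k|} else finsert k S)"

text \<open>The sign of moving the part \<open>k\<close> past all larger parts when a wedge product
  is written in decreasing order.\<close>

definition above_sign :: "nat \<Rightarrow> nat fset \<Rightarrow> real" where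
  "above_sign k S = (-1) ^ card {j \<in> fset S. k < j}"

text \<open>
  A finite set \<open>S\<close> of positive integers stands for the strict partition with these parts. For \<open>k > 0\<close>,
  \<open>phi k\<close> wedges with the part \<open>k\<close> from the left (parts in decreasing order), \<open>phi (- k)\<close> is \<open>(-1)\<^sup>k / 2\<close>
  times the removal of \<open>k\<close>, and \<open>phi 0\<close> is half the parity operator. All three have the form
  coefficient times reindexing; \<open>phi j f S\<close> is the coordinate at \<open>S\<close> of the image of the vector \<open>f\<close>.
\<close>

definition phi_coeff :: "int \<Rightarrow> nat fset \<Rightarrow> real" where
  "phi_coeff j S =
     (if j = 0 then (-1) ^ fcard S / 2
      else if (0 < j) = (nat \<bar>j\<bar> |\<in>| S) then above_sign (nat \<bar>j\<bar>) S * (if 0 < j then 1 else parity_sign j / 2)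
      else 0)"

definition phi_state :: "int \<Rightarrow> nat fset \<Rightarrow> nat fset" where
  "phi_state j S = (if j = 0 then S else toggle (nat \<bar>j\<bar>) S)"

definition phi :: "int \<Rightarrow> (nat fset \<Rightarrow> real) \<Rightarrow> nat fset \<Rightarrow> real" where
  "phi j f S = phi_coeff j S * f (phi_state j S)"

lemma mem_toggle [simp]: "k |\<in>| toggle l S \<longleftrightarrow> (k |\<in>| S) \<noteq> (k = l)"
  by (auto simp: toggle_def)

lemma toggle_toggle [simp]: "toggle k (toggle k S) = S"
  by (rule fset_eqI) auto

lemma toggle_commute: "toggle k (toggle l S) = toggle l (toggle k S)"
  by (rule fset_eqI) auto

lemma minus_one_power_card_toggle:
  "finite A \<Longrightarrow> (-1 :: real) ^ card (if k \<in> A then A - {k} else insert k A) = - ((-1) ^ card A)"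
proof -
  assume A: "finite A"
  show ?thesis
  proof (cases "k \<in> A")
    case True
    then have "card A = Suc (card (A - {k}))"
      using A by (metis card.remove)
    then show ?thesis
      using True by (simp only: if_True power_Suc)
  qed (use A in simp)
qed

lemma parity_toggle [simp]: "(-1 :: real) ^ fcard (toggle k S) = - ((-1) ^ fcard S)"
proof -
  have "fset (toggle k S) = (if k \<in> fset S then fset S - {k} else insert k (fset S))"
    by (auto simp: toggle_def)
  then show ?thesis
    using minus_one_power_card_toggle[of "fset S" k] by (simp add: fcard.rep_eq)
qed

text \<open>The comparison in \<open>above_sign\<close> is strict, so toggling \<open>k\<close>
  itself leaves the sign unchanged. Hence adding and removing the same part carry the same
  sign.\<close>

lemma above_sign_toggle:
  "above_sign k (toggle l S) = (if k < l then - above_sign k S else above_sign k S)"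
proof (cases "k < l")
  case True
  have "{j \<in> fset (toggle l S). k < j} =
      (if l \<in> {j \<in> fset S. k < j} then {j \<in> fset S. k < j} - {l} else insert l {j \<in> fset S. k < j})"
    using True by (auto simp: toggle_def)
  then show ?thesis
    using minus_one_power_card_toggle[of "{j \<in> fset S. k < j}" l] True
    by (simp add: above_sign_def)
next
  case False
  then have "{j \<in> fset (toggle l S). k < j} = {j \<in> fset S. k < j}"
    by (auto simp: toggle_def)
  then show ?thesis
    using False by (simp add: above_sign_def)
qed

lemma above_sign_square [simp]: "above_sign k S * above_sign k S = 1"
  by (simp add: above_sign_def flip: power_add)

lemma above_sign_square' [simp]: "above_sign k S * (above_sign k S * z) = z"
  by (simp flip: mult.assoc)

lemma parity_sign_simps [simp]: "parity_sign (- a) = parity_sign a"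
  "parity_sign (a + b) = parity_sign a * parity_sign b"
  "parity_sign (a - b) = parity_sign a * parity_sign b"
   "parity_sign a * parity_sign a = 1"
  by (auto simp: parity_sign_def)

lemma phi_state_commute: "phi_state a (phi_state b S) = phi_state b (phi_state a S)"
  by (simp add: phi_state_def toggle_commute)

lemma phi_state_uminus [simp]: "phi_state (- a) S = phi_state a S"
  by (simp add: phi_state_def)

lemma phi_state_idem [simp]: "phi_state a (phi_state a S) = S"
  by (simp add: phi_state_def)

text \<open>Toggles commute, so anticommutation is a matter of coefficients. For nonzero indices of
  different absolute values only the toggle of the larger part affects the sign of the smaller one,
  so exactly one of the two products changes sign. If one index is \<open>0\<close>, the other
  toggle flips the parity. For equal nonzero indices both products vanish; for opposite ones exactly
  one survives, with a squared sign.\<close>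

lemma phi_coeff_anticommute:
  "phi_coeff a S * phi_coeff b (phi_state a S) + phi_coeff b S * phi_coeff a (phi_state b S) =
     (if a + b = 0 then parity_sign a / 2 else 0)"
proof -
  consider "a = 0" "b = 0" | "a = 0" "b \<noteq> 0" | "a \<noteq> 0" "b = 0" | "a \<noteq> 0" "b = a" | "a \<noteq> 0" "b = -a"
    | "a \<noteq> 0" "b \<noteq> 0" "nat \<bar>a\<bar> \<noteq> nat \<bar>b\<bar>"
    by linarith
  then show ?thesis
  proof cases
    case 1
    then show ?thesis
      by (simp add: phi_coeff_def phi_state_def parity_sign_def flip: power_add)
  next
    case 2
    then show ?thesis
      by (simp add: phi_coeff_def phi_state_def)
  next
    case 3
    then show ?thesis
      by (simp add: phi_coeff_def phi_state_def)
  next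
    case 4
    then show ?thesis
      by (simp add: phi_coeff_def phi_state_def)
  next
    case 5
    then show ?thesis
      by (auto simp: phi_coeff_def phi_state_def above_sign_toggle)
  next
    case 6
    define p q where "p = nat \<bar>a\<bar>" and "q = nat \<bar>b\<bar>"
    have "a + b \<noteq> 0" using 6 by linarith
    moreover have "p < q \<or> q < p" using 6 by (auto simp: p_def q_def)
    ultimately show ?thesis
      unfolding phi_coeff_def phi_state_def p_def[symmetric] q_def[symmetric]
      using 6(1,2) by (elim disjE) (simp_all add: above_sign_toggle)
  qed
qed

lemma phi_anticommute:
  "phi a (phi b f) S = (if a + b = 0 then parity_sign a / 2 * f S else 0) - phi b (phi a f) S"
proof -
  have "phi a (phi b f) S + phi b (phi a f) S =
     (phi_coeff a S * phi_coeff b (phi_state a S) + phi_coeff b S * phi_coeff a (phi_state b S))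
       * f (phi_state a (phi_state b S))"
    by (simp add: phi_def phi_state_commute[of b a] algebra_simps)
  also have "\<dots> = (if a + b = 0 then parity_sign a / 2 * f S else 0)"
  proof (cases "a + b = 0")
    case True
    then have "b = -a" by simp
    then show ?thesis
      unfolding phi_coeff_anticommute by simp
  qed (simp add: phi_coeff_anticommute)
  finally show ?thesis by simp
qed

text \<open>The identity \<open>[AB, C] = A{B, C} - {A, C}B\<close>, where the anticommutators are
  scalars by \<open>phi_anticommute\<close>.\<close>

lemma phi_commutator:
  "phi a (phi b (phi j f)) S - phi j (phi a (phi b f)) S =
     (if b + j = 0 then parity_sign b / 2 * phi a f S else 0) - (if a + j = 0 then parity_sign a / 2 * phi b f S else 0)"
proof -
  have "phi a (phi b (phi j f)) S = phi_coeff a S * phi b (phi j f) (phi_state a S)"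
    by (simp add: phi_def)
  also have "\<dots> = (if b + j = 0 then parity_sign b / 2 * phi a f S else 0) - phi a (phi j (phi b f)) S"
    unfolding phi_anticommute[of b j] by (simp add: phi_def algebra_simps)
  also have "phi a (phi j (phi b f)) S = (if a + j = 0 then parity_sign a / 2 * phi b f S else 0) - phi j (phi a (phi b f)) S"
    by (rule phi_anticommute)
  finally show ?thesis by simp
qed

section \<open>Bosons as quadratic expressions in the fermions\<close>

definition weight :: "nat fset \<Rightarrow> nat" where
  "weight S = \<Sum>(fset S)"

lemma le_weight: "k |\<in>| S \<Longrightarrow> k \<le> weight S"
  unfolding weight_def by (rule member_le_sum) auto

text \<open>The sum ranges over all integers \<open>i\<close>; at \<open>S\<close>, the terms outside of the given range vanish
  (\<open>phi_phi_eq_0\<close>).\<close>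

definition boson :: "int \<Rightarrow> (nat fset \<Rightarrow> real) \<Rightarrow> nat fset \<Rightarrow> real" where
  "boson r f S = (let M = \<bar>r\<bar> + int (weight S) in \<Sum>i\<in>{- M..M}. parity_sign i * phi (r - i) (phi i f) S)"

text \<open>A creation has coordinate zero at a set that lacks the created part. One of
  \<open>i\<close> and \<open>r - i\<close> is positive and exceeds the weight of \<open>S\<close>.
  When it belongs to the inner operator, \<open>r\<close> nonzero ensures that the outer one does
  not toggle the same part.\<close>

lemma phi_phi_eq_0:
  assumes "r \<noteq> 0" "\<bar>i\<bar> > \<bar>r\<bar> + int (weight S)"
  shows "phi (r - i) (phi i f) S = 0"
proof (cases "i < 0")
  case True
  have "\<not> nat \<bar>r - i\<bar> |\<in>| S"
    using le_weight[of "nat \<bar>r - i\<bar>" S] assms True by linarith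
  then show ?thesis
    using True assms by (simp add: phi_def phi_coeff_def)
next
  case False
  have "\<not> nat \<bar>i\<bar> |\<in>| S"
    using le_weight[of "nat \<bar>i\<bar>" S] assms False by linarith
  moreover have "nat \<bar>i\<bar> \<noteq> nat \<bar>r - i\<bar>"
    using assms False by linarith
  moreover have "i \<noteq> 0" "i \<noteq> r"
    using assms False by linarith+
  ultimately have "phi i f (phi_state (r - i) S) = 0"
    using False assms by (simp add: phi_def phi_coeff_def phi_state_def)
  then show ?thesis
    by (simp add: phi_def[of "r - i"])
qed

text \<open>The range in \<open>boson\<close> depends on the evaluation point. Enlarging it lets
  values at different points be compared over one common interval.\<close>

lemma boson_eq:
  assumes "r \<noteq> 0" "finite I" "{- (\<bar>r\<bar> + int (weight S))..\<bar>r\<bar> + int (weight S)} \<subseteq> I"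
  shows "boson r f S = (\<Sum>i\<in>I. parity_sign i * phi (r - i) (phi i f) S)"
  unfolding boson_def Let_def
proof (rule sum.mono_neutral_left)
  show "\<forall>i\<in>I - {- (\<bar>r\<bar> + int (weight S))..\<bar>r\<bar> + int (weight S)}. parity_sign i * phi (r - i) (phi i f) S = 0"
    using assms(1) by (auto intro!: phi_phi_eq_0)
qed (use assms in auto)

lemma boson_add: "boson r (\<lambda>S. f S + g S) S = boson r f S + boson r g S"
  by (simp add: boson_def Let_def phi_def algebra_simps sum.distrib)

lemma boson_scale: "boson r (\<lambda>S. c * f S) S = c * boson r f S"
  by (simp add: boson_def Let_def phi_def algebra_simps sum_distrib_left)

lemma boson_sum: "boson r (\<lambda>S. \<Sum>x\<in>X. c x * f x S) S = (\<Sum>x\<in>X. c x * boson r (f x) S)"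
proof -
  have "boson r (\<lambda>S. \<Sum>x\<in>X. c x * f x S) S =
    (\<Sum>i\<in>{- (\<bar>r\<bar> + int (weight S))..\<bar>r\<bar> + int (weight S)}. \<Sum>x\<in>X. c x * (parity_sign i * phi (r - i) (phi i (f x)) S))"
    by (simp add: boson_def Let_def phi_def sum_distrib_left mult_ac)
  then show ?thesis
    by (subst (asm) sum.swap) (simp add: boson_def Let_def sum_distrib_left)
qed

lemma boson_sum': "boson r (\<lambda>S. \<Sum>x\<in>X. c x * f x S) = (\<lambda>S. \<Sum>x\<in>X. c x * boson r (f x) S)"
  by (rule ext) (rule boson_sum)

text \<open>By \<open>phi_commutator\<close> only \<open>i = - j\<close> and
  \<open>i = r + j\<close> contribute. As \<open>r\<close> is odd, these indices differ and the two
  halves of \<open>phi (j + r)\<close> add instead of cancelling.\<close>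

lemma boson_phi:
  assumes "odd r"
  shows "boson r (phi j f) S = phi j (boson r f) S + phi (j + r) f S"
proof -
  \<comment> \<open>Large enough for the ranges at \<open>S\<close> and at
    \<open>phi_state j S\<close> and for both contributing indices.\<close>
  define M where "M = 2 * \<bar>r\<bar> + \<bar>j\<bar> + int (weight S) + int (weight (phi_state j S))"
  have M: "boson r f (phi_state j S) = (\<Sum>i\<in>{-M..M}. parity_sign i * phi (r - i) (phi i f) (phi_state j S))"
    "boson r (phi j f) S = (\<Sum>i\<in>{-M..M}. parity_sign i * phi (r - i) (phi i (phi j f)) S)"
    using assms by (intro boson_eq; force simp: M_def)+
  have "r + j * 2 \<noteq> 0" using assms by (auto dest: arg_cong[of _ _ even])
  have "boson r (phi j f) S - phi j (boson r f) S =
     (\<Sum>i\<in>{-M..M}. parity_sign i * (phi (r - i) (phi i (phi j f)) S - phi j (phi (r - i) (phi i f)) S))"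
    unfolding M(2) phi_def[of j "boson r f"] M(1) by (simp add: phi_def[of j] algebra_simps sum_distrib_left sum_subtractf)
  also have "\<dots> = (\<Sum>i\<in>{-M..M}. (if i = -j then phi (r + j) f S / 2 else 0) + (if i = r + j then phi (r + j) f S / 2 else 0))"
    unfolding phi_commutator
  proof (intro sum.cong refl, goal_cases)
    case (1 i)
    consider "i = - j" | "i = r + j" | "i + j \<noteq> 0" "r - i + j \<noteq> 0" "i \<noteq> - j" "i \<noteq> r + j"
      by linarith
    then show ?case
    proof cases
      case 1
      moreover have "r - - j + j \<noteq> 0" "- j \<noteq> r + j"
        using \<open>r + j * 2 \<noteq> 0\<close> by simp_all
      ultimately show ?thesis by simp
    next
      case 2
      moreover have "r + j + j \<noteq> 0" "r + j \<noteq> - j"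
        using \<open>r + j * 2 \<noteq> 0\<close> by simp_all
      moreover have "parity_sign r = -1"
        using assms by (simp add: parity_sign_def)
      ultimately show ?thesis by simp
    qed simp
  qed
  also have "\<dots> = phi (r + j) f S"
  proof -
    have "- j \<in> {- M..M}" "r + j \<in> {- M..M}"
      by (auto simp: M_def)
    then show ?thesis
      unfolding sum.distrib by simp
  qed
  finally show ?thesis by (simp add: add.commute)
qed

lemma phi_zero_fun [simp]: "phi a (\<lambda>S. 0) = (\<lambda>S. 0)"
  by (simp add: phi_def fun_eq_iff)

lemma boson_zero [simp]: "boson r (\<lambda>S. 0) = (\<lambda>S. 0)"
  by (simp add: boson_def fun_eq_iff)

definition boson_comm :: "int \<Rightarrow> int \<Rightarrow> (nat fset \<Rightarrow> real) \<Rightarrow> nat fset \<Rightarrow> real" where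
  "boson_comm s r f S = boson s (boson r f) S - boson r (boson s f) S"

lemma boson_phi': "odd r \<Longrightarrow> boson r (phi j f) = (\<lambda>S. phi j (boson r f) S + phi (j + r) f S)"
  by (rule ext) (rule boson_phi)

text \<open>Moving both bosons past \<open>phi j\<close> leaves mixed terms in
  \<open>phi (j + r)\<close> and \<open>phi (j + s)\<close> and one in
  \<open>phi (j + r + s)\<close>, which are the same for either order of the bosons.\<close>

lemma boson_comm_phi:
  assumes "odd r" "odd s"
  shows "boson_comm s r (phi j f) S = phi j (boson_comm s r f) S"
proof -
  have "boson_comm s r (phi j f) S = phi j (boson s (boson r f)) S - phi j (boson r (boson s f)) S"
    using assms by (simp add: boson_comm_def boson_phi' boson_add add.assoc add.commute[of r s])
  then show ?thesis
    by (simp add: boson_comm_def phi_def algebra_simps)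
qed

section \<open>Grading by weight and basis vectors\<close>

text \<open>A finite set of naturals may contain \<open>0\<close>, which is no part, so
  \<open>0\<close> is excluded here. Degrees are integers so that operators of any index can shift
  them; negative degrees give the empty set.\<close>

definition states :: "int \<Rightarrow> nat fset set" where
  "states n = {S. \<not> 0 |\<in>| S \<and> int (weight S) = n}"

definition graded :: "int \<Rightarrow> (nat fset \<Rightarrow> real) \<Rightarrow> bool" where
  "graded n f \<longleftrightarrow> (\<forall>S. S \<notin> states n \<longrightarrow> f S = 0)"

definition ket :: "nat fset \<Rightarrow> nat fset \<Rightarrow> real" where
  "ket S T = (if T = S then 1 else 0)"

lemma weight_finsert: "\<not> k |\<in>| S \<Longrightarrow> weight (finsert k S) = k + weight S"
  by (simp add: weight_def)

lemma weight_fminus: "k |\<in>| S \<Longrightarrow> weight S = k + weight (S |-| {|k|})"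
  using sum.remove[of "fset S" k "\<lambda>k. k"] by (simp add: weight_def)

lemma states_finsert: "0 < k \<Longrightarrow> \<not> k |\<in>| S \<Longrightarrow> finsert k S \<in> states (n + int k) \<longleftrightarrow> S \<in> states n"
  by (auto simp: states_def weight_finsert)

lemma states_fminus:
  "0 < k \<Longrightarrow> k |\<in>| S \<Longrightarrow> S |-| {|k|} \<in> states n \<longleftrightarrow> S \<in> states (n + int k)"
  using weight_fminus[of k S] by (auto simp: states_def)

lemma finite_states [simp]: "finite (states n)"
proof (rule finite_subset)
  show "states n \<subseteq> Abs_fset ` Pow {..nat n}"
  proof
    fix S assume S: "S \<in> states n"
    have "fset S \<subseteq> {..nat n}"
      using S le_weight[of _ S] by (fastforce simp: states_def)
    then show "S \<in> Abs_fset ` Pow {..nat n}"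
      by (metis PowI fset_inverse image_eqI)
  qed
qed simp

lemma states_neg: "n < 0 \<Longrightarrow> states n = {}"
  by (auto simp: states_def)

lemma states_0: "states 0 = {{||}}"
proof
  show "states 0 \<subseteq> {{||}}"
  proof
    fix S assume "S \<in> states 0"
    then have S: "\<not> 0 |\<in>| S" "weight S = 0"
      by (simp_all add: states_def)
    have "S = {||}"
    proof (rule fset_eqI)
      show "k |\<in>| S \<longleftrightarrow> k |\<in>| {||}" for k
        using le_weight[of k S] S by auto
    qed
    then show "S \<in> {{||}}"
      by simp
  qed
qed (simp add: states_def weight_def)

lemma phi_pos: "0 < k \<Longrightarrow> phi (int k) f S = (if k |\<in>| S then above_sign k S * f (S |-| {|k|}) else 0)"
  by (simp add: phi_def phi_coeff_def phi_state_def toggle_def)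

lemma phi_neg:
  "0 < k \<Longrightarrow> phi (- int k) f S = (if k |\<in>| S then 0 else above_sign k S * parity_sign (int k) / 2 * f (finsert k S))"
  by (simp add: phi_def phi_coeff_def phi_state_def toggle_def)

lemma phi_zero: "phi 0 f S = (-1) ^ fcard S / 2 * f S"
  by (simp add: phi_def phi_coeff_def phi_state_def)

lemma int_sign_cases:
  obtains (zero) "j = (0 :: int)" | (pos) k where "j = int k" "k > 0" | (neg) k where "j = - int k" "k > 0"
proof -
  have "j = 0 \<or> j = int (nat j) \<and> nat j > 0 \<or> j = - int (nat (- j)) \<and> nat (- j) > 0"
    by linarith
  then show ?thesis using that by blast
qed

lemma graded_phi:
  assumes "graded n f"
  shows "graded (n + j) (phi j f)"
  unfolding graded_def
proof (intro allI impI)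
  fix S assume S: "S \<notin> states (n + j)"
  show "phi j f S = 0"
  proof (cases j rule: int_sign_cases)
    case (pos k)
    then show ?thesis
      using assms S states_fminus[of k S n] by (simp add: graded_def phi_pos)
  next
    case (neg k)
    then show ?thesis
      using assms S states_finsert[of k S "n - int k"] by (simp add: graded_def phi_neg)
  next
    case zero
    then show ?thesis
      using assms S by (simp add: graded_def phi_zero)
  qed
qed

lemma graded_boson: "graded n f \<Longrightarrow> graded (n + r) (boson r f)"
proof -
  assume f: "graded n f"
  have "graded (n + r) (phi (r - i) (phi i f))" for i
    using graded_phi[OF graded_phi[OF f, of i], of "r - i"] by simp
  then show ?thesis
    by (simp add: graded_def boson_def)
qed

lemma graded_ket: "S \<in> states n \<Longrightarrow> graded n (ket S)"
  by (auto simp: graded_def ket_def)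

lemma graded_expand:
  assumes "graded n f"
  shows "f = (\<lambda>T. \<Sum>S\<in>states n. f S * ket S T)"
proof
  fix T
  have "(\<Sum>S\<in>states n. f S * ket S T) = (\<Sum>S\<in>states n. if T = S then f S else 0)"
    by (intro sum.cong) (auto simp: ket_def)
  also have "\<dots> = f T"
    using assms by (auto simp: graded_def)
  finally show "f T = (\<Sum>S\<in>states n. f S * ket S T)" by simp
qed

lemma phi_ket: "0 < k \<Longrightarrow> \<not> k |\<in>| S \<Longrightarrow> phi (int k) (ket S) = (\<lambda>T. above_sign k S * ket (finsert k S) T)"
proof (rule ext)
  fix T assume k: "0 < k" "\<not> k |\<in>| S"
  have "above_sign k (finsert k S) = above_sign k S"
    using above_sign_toggle[of k k S] k by (simp add: toggle_def)
  moreover have "T |-| {|k|} = S \<longleftrightarrow> T = finsert k S" if "k |\<in>| T"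
    using that k by auto
  ultimately show "phi (int k) (ket S) T = above_sign k S * ket (finsert k S) T"
    using k by (auto simp: phi_pos ket_def)
qed

lemma above_sign_max: "(\<And>j. j |\<in>| S \<Longrightarrow> j \<le> k) \<Longrightarrow> above_sign k S = 1"
proof -
  assume "\<And>j. j |\<in>| S \<Longrightarrow> j \<le> k"
  then have "{j \<in> fset S. k < j} = {}"
    by (auto simp: not_less)
  then show ?thesis
    by (simp only: above_sign_def card.empty power_0)
qed

text \<open>A part larger than all others is created without a sign, so building a set upwards
  expresses \<open>ket\<close>, and later \<open>Pfun\<close>, by creations alone.\<close>

lemma fset_max_induct [case_names empty insert]:
  fixes S :: "'a :: linorder fset"
  assumes "P {||}" "\<And>k S. (\<And>j. j |\<in>| S \<Longrightarrow> j < k) \<Longrightarrow> P S \<Longrightarrow> P (finsert k S)"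
  shows "P S"
proof -
  have "P (Abs_fset A)" if "finite A" for A
    using that
  proof (induction rule: finite_linorder_max_induct)
    case empty
    then show ?case using assms(1) by (simp add: bot_fset.abs_eq)
  next
    case (insert b A)
    have "Abs_fset (insert b A) = finsert b (Abs_fset A)"
      using insert by (simp add: finsert.abs_eq eq_onp_same_args)
    then show ?case
      using assms(2)[of "Abs_fset A" b] insert by (simp add: Abs_fset_inverse)
  qed
  from this[of "fset S"] show ?thesis by (simp add: fset_inverse)
qed

lemma ket_insert_max:
  assumes "\<And>j. j |\<in>| S \<Longrightarrow> j < k" "0 < k"
  shows "ket (finsert k S) = phi (int k) (ket S)"
proof -
  have "\<not> k |\<in>| S" using assms by blast
  moreover have "above_sign k S = 1"
    using assms(1) by (intro above_sign_max) (simp add: less_imp_le)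
  ultimately show ?thesis
    using phi_ket[of k S] assms(2) by simp
qed

section \<open>The vacuum and the commutators of bosons\<close>

text \<open>The image has degree \<open>- r\<close>, and there are no states of negative
  weight.\<close>

lemma boson_empty_neg: "0 < r \<Longrightarrow> boson (- r) (ket {||}) = (\<lambda>_. 0)"
proof -
  assume "0 < r"
  have "graded 0 (ket {||})"
    by (rule graded_ket) (simp add: states_0)
  then have "graded (0 + - r) (boson (- r) (ket {||}))"
    by (rule graded_boson)
  moreover have "states (0 + - r) = {}"
    by (rule states_neg) (use \<open>0 < r\<close> in simp)
  ultimately show ?thesis
    unfolding graded_def by blast
qed

lemma phi_neg_ket_empty: "0 < k \<Longrightarrow> phi (- int k) (ket {||}) = (\<lambda>_. 0)"
  by (auto simp: phi_neg ket_def fun_eq_iff)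

lemma phi_zero_ket_empty: "phi 0 (ket {||}) = (\<lambda>S. ket {||} S / 2)"
  by (auto simp: phi_zero ket_def fun_eq_iff fcard_fempty)

lemma phi_phi_ket_empty:
  assumes "0 < k" "k \<noteq> l" "0 < l"
  shows "phi (- int k) (phi (int l) (ket {||})) S = 0"
  using phi_anticommute[of "- int k" "int l" "ket {||}"] assms
  by (simp add: phi_neg_ket_empty)

text \<open>For negative \<open>i\<close> the inner operator annihilates the vacuum, and for
  \<open>i > r\<close> the outer annihilation passes through the creation of a different part. The
  terms \<open>i = 0\<close> and \<open>i = r\<close> involve \<open>phi 0\<close> and each give
  half of \<open>phi r\<close>.\<close>

lemma boson_ket_empty:
  assumes "odd r" "0 < r"
  shows "boson (int r) (ket {||}) S = phi (int r) (ket {||}) S +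
    (\<Sum>i\<in>{1..<r}. parity_sign (int i) * phi (int (r - i)) (phi (int i) (ket {||})) S)"
proof -
  define M where "M = r + weight S"
  let ?t = "\<lambda>i. parity_sign i * phi (int r - i) (phi i (ket {||})) S"
  have "boson (int r) (ket {||}) S = (\<Sum>i\<in>{- int M..int M}. ?t i)"
    using assms by (intro boson_eq) (auto simp: M_def)
  also have "\<dots> = (\<Sum>i\<in>{0..int r}. ?t i)"
  proof (rule sum.mono_neutral_right)
    show "\<forall>i\<in>{- int M..int M} - {0..int r}. ?t i = 0"
    proof
      fix i assume i: "i \<in> {- int M..int M} - {0..int r}"
      show "?t i = 0"
      proof (cases "i < 0")
        case True
        then show ?thesis
          using phi_neg_ket_empty[of "nat (- i)"] by simp
      next
        case False
        then have "int r - i = - int (nat (i - int r))" "i = int (nat i)" "nat (i - int r) \<noteq> nat i"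
          "0 < nat (i - int r)" "0 < nat i"
          using i assms by auto
        then show ?thesis
          using phi_phi_ket_empty[of "nat (i - int r)" "nat i" S] by (metis mult_zero_right)
      qed
    qed
  qed (use assms in \<open>auto simp: M_def\<close>)
  also have "{0..int r} = int ` {0..r}"
    by (simp add: image_int_atLeastAtMost)
  also have "(\<Sum>i\<in>int ` {0..r}. ?t i) = (\<Sum>i\<in>{0..r}. ?t (int i))"
    by (subst sum.reindex) auto
  also have "{0..r} = insert 0 (insert r {1..<r})"
    using assms by auto
  also have "(\<Sum>i\<in>insert 0 (insert r {1..<r}). ?t (int i)) = ?t 0 + ?t (int r) + (\<Sum>i\<in>{1..<r}. ?t (int i))"
    using assms by simp
  also have "(\<Sum>i\<in>{1..<r}. ?t (int i)) =
      (\<Sum>i\<in>{1..<r}. parity_sign (int i) * phi (int (r - i)) (phi (int i) (ket {||})) S)"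
    by (intro sum.cong) (auto simp: of_nat_diff)
  also have "?t 0 = phi (int r) (ket {||}) S / 2"
    by (simp add: parity_sign_def phi_zero_ket_empty phi_def[of "int r"])
  also have "?t (int r) = phi (int r) (ket {||}) S / 2"
    using assms phi_anticommute[of 0 "int r" "ket {||}" S]
    by (simp add: parity_sign_def phi_zero_ket_empty phi_def[of "int r"])
  finally show ?thesis by simp
qed

lemma graded_boson_comm_ket_empty: "graded (r + s) (boson_comm s r (ket {||}))"
proof -
  have "graded 0 (ket {||})"
    by (rule graded_ket) (simp add: states_0)
  then have "graded (0 + r + s) (boson s (boson r (ket {||})))" "graded (0 + s + r) (boson r (boson s (ket {||})))"
    by (blast intro: graded_boson)+
  then show ?thesis
    by (simp add: boson_comm_def graded_def add.commute[of s r])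
qed

text \<open>The commutator commutes with every annihilation, so its value on the vacuum is killed by
  all of them. Annihilating a positive part \<open>k\<close> and evaluating at \<open>S\<close>
  without \<open>k\<close> reads off the coordinate at \<open>S\<close> up to a nonzero factor, so
  that coordinate vanishes. Sets containing \<open>0\<close> are excluded by the grading.\<close>

lemma boson_comm_ket_empty:
  assumes "odd r" "odd s"
  shows "boson_comm s r (ket {||}) = (\<lambda>S. boson_comm s r (ket {||}) {||} * ket {||} S)"
proof
  fix S
  have g: "graded (r + s) (boson_comm s r (ket {||}))"
    by (rule graded_boson_comm_ket_empty)
  show "boson_comm s r (ket {||}) S = boson_comm s r (ket {||}) {||} * ket {||} S"
  proof (cases "S = {||}")
    case False
    then obtain k where k: "k |\<in>| S" by auto
    show ?thesis
    proof (cases "k = 0")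
      case True
      then show ?thesis
        using g k False by (simp add: graded_def states_def ket_def)
    next
      case k0: False
      have "phi (- int k) (boson_comm s r (ket {||})) (S |-| {|k|}) = 0"
        using boson_comm_phi[OF assms, of "- int k" "ket {||}"] phi_neg_ket_empty[of k] k0
        by (simp add: boson_comm_def)
      then have "boson_comm s r (ket {||}) (finsert k (S |-| {|k|})) = 0"
        using k0 by (simp add: phi_neg above_sign_def parity_sign_def split: if_splits)
      then show ?thesis
        using False k by (simp add: ket_def finsert_absorb)
    qed
  qed (simp add: ket_def)
qed

text \<open>Creations build every basis vector from the vacuum and commute with
  \<open>boson_comm\<close>, so the scalar on the vacuum is the scalar everywhere.\<close>

lemma boson_comm_eq_scale:
  assumes "odd r" "odd s" "graded n f"
  shows "boson_comm s r f S = boson_comm s r (ket {||}) {||} * f S"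
proof -
  let ?c = "boson_comm s r (ket {||}) {||}"
  have ket: "boson_comm s r (ket S) = (\<lambda>T. ?c * ket S T)" if "\<not> 0 |\<in>| S" for S
    using that
  proof (induction S rule: fset_max_induct)
    case empty
    then show ?case using boson_comm_ket_empty[OF assms(1,2)] by simp
  next
    case (insert k S)
    then have *: "ket (finsert k S) = phi (int k) (ket S)"
      by (intro ket_insert_max) auto
    have IH: "boson_comm s r (ket S) = (\<lambda>T. ?c * ket S T)"
      using insert by auto
    show ?case
      unfolding * by (rule ext, subst boson_comm_phi[OF assms(1,2)], subst IH) (simp add: phi_def)
  qed
  have "boson_comm s r f S = boson_comm s r (\<lambda>T. \<Sum>U\<in>states n. f U * ket U T) S"
    using graded_expand[OF assms(3)] by metis
  also have "\<dots> = (\<Sum>T\<in>states n. f T * boson_comm s r (ket T) S)"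
    by (simp add: boson_comm_def boson_sum' sum_subtractf right_diff_distrib)
  also have "\<dots> = (\<Sum>T\<in>states n. ?c * (f T * ket T S))"
  proof (intro sum.cong refl)
    fix T assume "T \<in> states n"
    then have "boson_comm s r (ket T) S = ?c * ket T S"
      by (intro fun_cong[OF ket]) (simp add: states_def)
    then show "f T * boson_comm s r (ket T) S = ?c * (f T * ket T S)"
      by (simp only: mult_ac)
  qed
  also have "\<dots> = ?c * f S"
    using fun_cong[OF graded_expand[OF assms(3)], of S] by (simp add: sum_distrib_left)
  finally show ?thesis .
qed

text \<open>The scalar is the vacuum coordinate of a vector of degree \<open>r + s\<close>, which is
  not the degree of the vacuum.\<close>

lemma boson_commute:
  assumes "odd r" "odd s" "graded n f" "r + s \<noteq> 0"
  shows "boson s (boson r f) = boson r (boson s f)"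
proof -
  have "boson_comm s r (ket {||}) {||} = 0"
    using graded_boson_comm_ket_empty[of r s] assms(4) by (simp add: graded_def states_def weight_def)
  then have "boson_comm s r f S = 0" for S
    by (subst boson_comm_eq_scale[OF assms(1-3)]) simp
  then show ?thesis
    by (simp add: boson_comm_def fun_eq_iff)
qed

text \<open>In the expansion of \<open>boson_ket_empty\<close> the linear term and each of the
  \<open>r - 1\<close> quadratic terms contribute one half.\<close>

lemma boson_comm_uminus_ket_empty:
  assumes "odd r" "0 < r"
  shows "boson_comm (- int r) (int r) (ket {||}) {||} = r / 2"
proof -
  have 1: "boson (- int r) (phi (int r) (ket {||})) {||} = 1 / 2"
    using boson_phi[of "- int r" "int r" "ket {||}" "{||}"] assms
    by (simp add: boson_empty_neg phi_zero_ket_empty ket_def)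
  have 2: "boson (- int r) (phi (int (r - i)) (phi (int i) (ket {||}))) {||} = parity_sign (int i) / 2" if "i \<in> {1..<r}" for i
  proof -
    have "phi (int (r - i)) f {||} = 0" for f
      using that by (subst phi_pos) auto
    moreover have "int (r - i) + - int r = - int i"
      using that by simp
    moreover have "boson (- int r) (phi (int (r - i)) f) {||} =
        phi (int (r - i)) (boson (- int r) f) {||} + phi (int (r - i) + - int r) f {||}" for f
      using assms by (intro boson_phi) simp
    ultimately have "boson (- int r) (phi (int (r - i)) (phi (int i) (ket {||}))) {||} =
       phi (- int i) (phi (int i) (ket {||})) {||}"
      by (simp only: add_0)
    also have "\<dots> = parity_sign (int i) / 2"
      using phi_anticommute[of "- int i" "int i" "ket {||}" "{||}"] that
      by (simp add: phi_neg_ket_empty ket_def)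
    finally show ?thesis .
  qed
  have "boson_comm (- int r) (int r) (ket {||}) {||} = boson (- int r) (boson (int r) (ket {||})) {||}"
    using assms by (simp add: boson_comm_def boson_empty_neg)
  also have "\<dots> = boson (- int r) (phi (int r) (ket {||})) {||} +
      (\<Sum>i\<in>{1..<r}. parity_sign (int i) * boson (- int r) (phi (int (r - i)) (phi (int i) (ket {||}))) {||})"
    by (simp only: boson_ket_empty[OF assms, abs_def] boson_add boson_sum)
  also have "\<dots> = 1 / 2 + (\<Sum>i\<in>{1..<r}. parity_sign (int i) * (parity_sign (int i) / 2))"
    by (simp only: 1 2 cong: sum.cong)
  also have "\<dots> = r / 2"
    using assms by (simp add: of_nat_diff field_simps)
  finally show ?thesis .
qed

lemma boson_uminus_boson:
  assumes "odd r" "0 < r" "graded n f"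
  shows "boson (- int r) (boson (int r) f) S = boson (int r) (boson (- int r) f) S + r / 2 * f S"
proof -
  have "boson_comm (- int r) (int r) f S = r / 2 * f S"
    using boson_comm_eq_scale[of "int r" "- int r" n f S] assms
    by (simp only: boson_comm_uminus_ket_empty[OF assms(1,2)]) simp
  then show ?thesis
    by (simp add: boson_comm_def)
qed

section \<open>Power sums in the Fock space\<close>

text \<open>Removing \<open>k\<close> matches the sets that contain it with those that do not. This
  reindexing yields both the adjoint of a creation and its effect on functions.\<close>

lemma sum_states_insert:
  assumes "0 < k"
  shows "(\<Sum>S\<in>states (n + int k). if k |\<in>| S then F S else 0) =
    (\<Sum>T\<in>states n. if k |\<in>| T then 0 else F (finsert k T))"
proof -
  have "(\<Sum>S\<in>states (n + int k). if k |\<in>| S then F S else 0) =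
      (\<Sum>S\<in>{S \<in> states (n + int k). k |\<in>| S}. F S)"
    by (simp add: sum.inter_filter)
  also have "\<dots> = (\<Sum>T\<in>{T \<in> states n. \<not> k |\<in>| T}. F (finsert k T))"
    by (rule sum.reindex_bij_witness[of _ "finsert k" "\<lambda>S. S |-| {|k|}"])
      (use assms states_finsert[of k] states_fminus[of k] in \<open>auto simp: finsert_absorb\<close>)
  also have "\<dots> = (\<Sum>T\<in>states n. if \<not> k |\<in>| T then F (finsert k T) else 0)"
    by (simp add: sum.inter_filter)
  also have "\<dots> = (\<Sum>T\<in>states n. if k |\<in>| T then 0 else F (finsert k T))"
    by (intro sum.cong) auto
  finally show ?thesis .
qed

definition fock_inner :: "int \<Rightarrow> (nat fset \<Rightarrow> real) \<Rightarrow> (nat fset \<Rightarrow> real) \<Rightarrow> real" where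
  "fock_inner n f g = (\<Sum>S\<in>states n. f S * g S / 2 ^ fcard S)"

lemma fock_inner_commute: "fock_inner n f g = fock_inner n g f"
  by (simp add: fock_inner_def mult.commute)

text \<open>The factor one half in the coefficient of an annihilation is the ratio of the weights in
  \<open>fock_inner\<close> of two sets that differ by one part.\<close>

lemma fock_inner_phi_pos:
  assumes "0 < k"
  shows "fock_inner (n + int k) (phi (int k) f) g = parity_sign (int k) * fock_inner n f (phi (- int k) g)"
proof -
  have above: "above_sign k (finsert k T) = above_sign k T" if "\<not> k |\<in>| T" for T
    using that above_sign_toggle[of k k T] by (simp add: toggle_def)
  have "fock_inner (n + int k) (phi (int k) f) g =
     (\<Sum>S\<in>states (n + int k). if k |\<in>| S then above_sign k S * f (S |-| {|k|}) * g S / 2 ^ fcard S else 0)"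
    unfolding fock_inner_def using assms by (intro sum.cong) (auto simp: phi_pos)
  also have "\<dots> = (\<Sum>T\<in>states n. if k |\<in>| T then 0 else
      above_sign k (finsert k T) * f (finsert k T |-| {|k|}) * g (finsert k T) / 2 ^ fcard (finsert k T))"
    by (rule sum_states_insert[OF assms])
  also have "\<dots> = (\<Sum>T\<in>states n. parity_sign (int k) * (f T * phi (- int k) g T / 2 ^ fcard T))"
  proof (intro sum.cong refl)
    fix T
    have "k |\<notin>| T \<Longrightarrow> finsert k T |-| {|k|} = T"
      by auto
    then show "(if k |\<in>| T then 0 else
      above_sign k (finsert k T) * f (finsert k T |-| {|k|}) * g (finsert k T) / 2 ^ fcard (finsert k T)) =
      parity_sign (int k) * (f T * phi (- int k) g T / 2 ^ fcard T)"
      using assms by (auto simp: phi_neg above fcard_finsert_disjoint parity_sign_def)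
  qed
  finally show ?thesis
    by (simp add: fock_inner_def sum_distrib_left)
qed

lemma fock_inner_phi: "fock_inner n (phi a f) g = parity_sign a * fock_inner (n - a) f (phi (- a) g)"
proof (cases a rule: int_sign_cases)
  case zero
  then show ?thesis
    by (simp add: fock_inner_def phi_zero parity_sign_def mult_ac)
next
  case (pos k)
  then show ?thesis
    using fock_inner_phi_pos[of k "n - int k" f g] by simp
next
  case (neg k)
  then have "parity_sign a * fock_inner (n - a) f (phi (- a) g) = parity_sign (int k) * (parity_sign (int k) * fock_inner n g (phi (- int k) f))"
    using fock_inner_phi_pos[of k n g f] by (simp add: fock_inner_commute)
  then show ?thesis
    using neg by (simp add: fock_inner_commute flip: mult.assoc)
qed

lemma fock_inner_sum_left: "fock_inner n (\<lambda>S. \<Sum>x\<in>X. c x * f x S) g = (\<Sum>x\<in>X. c x * fock_inner n (f x) g)"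
  unfolding fock_inner_def sum_distrib_left sum_distrib_right sum_divide_distrib
  by (subst sum.swap) (simp add: mult_ac)

lemma fock_inner_sum_right: "fock_inner n g (\<lambda>S. \<Sum>x\<in>X. c x * f x S) = (\<Sum>x\<in>X. c x * fock_inner n g (f x))"
  by (simp add: fock_inner_commute[of n g] fock_inner_sum_left)

lemma fock_inner_cong: "(\<And>S. S \<in> states n \<Longrightarrow> f S = f' S) \<Longrightarrow> (\<And>S. S \<in> states n \<Longrightarrow> g S = g' S) \<Longrightarrow> fock_inner n f g = fock_inner n f' g'"
  by (simp add: fock_inner_def)

text \<open>Taking adjoints reverses the two fermions and negates their indices. Shifting the
  summation index by \<open>r\<close> restores the shape of a boson, and the signs combine to the
  one attached to the new index.\<close>

lemma fock_inner_boson: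
  assumes "odd r"
  shows "fock_inner n (boson r f) g = fock_inner (n - r) f (boson (- r) g)"
proof -
  \<comment> \<open>Covers the summation range in degree \<open>n\<close> and, after the shift by
    \<open>r\<close>, the one in degree \<open>n - r\<close>.\<close>
  define M where "M = 3 * \<bar>r\<bar> + \<bar>n\<bar>"
  have "fock_inner n (boson r f) g = fock_inner n (\<lambda>S. \<Sum>i\<in>{-M..M}. parity_sign i * phi (r - i) (phi i f) S) g"
    using assms by (intro fock_inner_cong boson_eq) (auto simp: M_def states_def)
  also have "\<dots> = (\<Sum>i\<in>{-M..M}. parity_sign (i - r) * fock_inner (n - r) f (phi (- i) (phi (i - r) g)))"
    unfolding fock_inner_sum_left
  proof (intro sum.cong refl)
    fix i
    have "parity_sign i * fock_inner n (phi (r - i) (phi i f)) g =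
        (parity_sign i * parity_sign i * parity_sign i) * parity_sign r * fock_inner (n - (r - i) - i) f (phi (- i) (phi (- (r - i)) g))"
      by (simp only: fock_inner_phi[of _ "r - i"] fock_inner_phi[of _ i] parity_sign_simps(3) mult_ac)
    then show "parity_sign i * fock_inner n (phi (r - i) (phi i f)) g = parity_sign (i - r) * fock_inner (n - r) f (phi (- i) (phi (i - r) g))"
      by simp
  qed
  also have "\<dots> = (\<Sum>i\<in>{- M - r..M - r}. parity_sign i * fock_inner (n - r) f (phi (- r - i) (phi i g)))"
    by (rule sum.reindex_bij_witness[of _ "\<lambda>i. i + r" "\<lambda>i. i - r"]) auto
  also have "\<dots> = fock_inner (n - r) f (\<lambda>S. \<Sum>i\<in>{- M - r..M - r}. parity_sign i * phi (- r - i) (phi i g) S)"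
    by (simp only: fock_inner_sum_right)
  also have "\<dots> = fock_inner (n - r) f (boson (- r) g)"
    using assms by (intro fock_inner_cong boson_eq[symmetric] refl) (auto simp: M_def states_def)
  finally show ?thesis .
qed

section \<open>Vectors of power sums and their orthogonality\<close>

definition fock_vec :: "nat list \<Rightarrow> nat fset \<Rightarrow> real" where
  "fock_vec m = foldr (\<lambda>k. boson (int k)) m (ket {||})"

lemma fock_vec_Nil: "fock_vec [] = ket {||}"
  by (simp add: fock_vec_def)

lemma fock_vec_Cons: "fock_vec (k # m) = boson (int k) (fock_vec m)"
  by (simp add: fock_vec_def)

lemma graded_fock_vec: "graded (int (sum_list m)) (fock_vec m)"
proof (induction m)
  case Nil
  then show ?case
    using graded_ket[of "{||}" 0] by (simp add: fock_vec_Nil states_0)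
next
  case (Cons k m)
  then show ?case
    using graded_boson[OF Cons.IH, of "int k"] by (simp add: fock_vec_Cons add.commute)
qed

lemma fock_vec_remove1:
  assumes "k \<in> set m" "\<forall>j\<in>set m. odd j"
  shows "fock_vec (k # remove1 k m) = fock_vec m"
  using assms
proof (induction m)
  case (Cons j m)
  show ?case
  proof (cases "j = k")
    case False
    have "boson (int k) (boson (int j) (fock_vec (remove1 k m))) = boson (int j) (boson (int k) (fock_vec (remove1 k m)))"
      using Cons.prems odd_pos[of j] by (intro boson_commute[OF _ _ graded_fock_vec]) auto
    then show ?thesis
      using Cons False by (simp add: fock_vec_Cons)
  qed simp
qed simp

text \<open>By the commutation relations \<open>boson (- r)\<close> acts on monomials in the
  positive bosons as \<open>r / 2\<close> times the derivative with respect to the boson of index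
  \<open>r\<close>.\<close>

lemma boson_uminus_fock_vec:
  assumes "odd r" "\<forall>j\<in>set m. odd j"
  shows "boson (- int r) (fock_vec m) S = real r / 2 * real (mult_part r m) * fock_vec (remove1 r m) S"
  using assms(2)
proof (induction m arbitrary: S)
  case Nil
  then show ?case
    using boson_empty_neg[of "int r"] odd_pos[OF assms(1)] by (simp add: fock_vec_Nil mult_part_def)
next
  case (Cons j m)
  have IH: "boson (- int r) (fock_vec m) = (\<lambda>S. real r / 2 * real (mult_part r m) * fock_vec (remove1 r m) S)"
    using Cons by auto
  show ?case
  proof (cases "j = r")
    case False
    have "boson (- int r) (boson (int j) (fock_vec m)) = boson (int j) (boson (- int r) (fock_vec m))"
      using Cons.prems assms False by (intro boson_commute[OF _ _ graded_fock_vec]) auto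
    moreover have "mult_part r (j # m) = mult_part r m" "remove1 r (j # m) = j # remove1 r m"
      using False by (simp_all add: mult_part_def)
    ultimately show ?thesis
      by (simp only: fock_vec_Cons IH boson_scale)
  next
    case True
    have "boson (- int r) (boson (int r) (fock_vec m)) S = boson (int r) (boson (- int r) (fock_vec m)) S + r / 2 * fock_vec m S"
      using assms odd_pos[OF assms(1)] by (intro boson_uminus_boson[OF _ _ graded_fock_vec])
    also have "boson (int r) (boson (- int r) (fock_vec m)) S = real r / 2 * real (mult_part r m) * fock_vec m S"
    proof (cases "r \<in> set m")
      case r: True
      have "boson (int r) (fock_vec (remove1 r m)) = fock_vec m"
        using fock_vec_remove1[OF r] Cons.prems by (simp add: fock_vec_Cons)
      then show ?thesis
        by (simp only: IH boson_scale)
    next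
      case False
      then have "mult_part r m = 0"
        by (simp add: mult_part_def)
      then show ?thesis
        by (simp add: IH)
    qed
    finally show ?thesis
      using True by (simp add: fock_vec_Cons mult_part_def algebra_simps)
  qed
qed

text \<open>A recursion in the shape needed to absorb the index and multiplicity factors of
  \<open>boson_uminus_fock_vec\<close>.\<close>

lemma z_part_Cons: "z_part (k # m) = k * Suc (mult_part k m) * z_part m"
proof -
  let ?w = "\<lambda>l i. i ^ mult_part i l * fact (mult_part i l) :: nat"
  have wk: "?w (k # m) k = k * Suc (mult_part k m) * ?w m k"
    by (simp add: mult_part_def algebra_simps)
  have "z_part (k # m) = ?w (k # m) k * (\<Prod>i\<in>set m - {k}. ?w (k # m) i)"
    unfolding z_part_def by (simp add: prod.insert_remove)
  also have "(\<Prod>i\<in>set m - {k}. ?w (k # m) i) = (\<Prod>i\<in>set m - {k}. ?w m i)"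
    by (intro prod.cong) (auto simp: mult_part_def)
  finally have *: "z_part (k # m) = k * Suc (mult_part k m) * (?w m k * (\<Prod>i\<in>set m - {k}. ?w m i))"
    by (simp only: wk mult.assoc)
  have "?w m k * (\<Prod>i\<in>set m - {k}. ?w m i) = z_part m"
  proof (cases "k \<in> set m")
    case True
    then show ?thesis
      unfolding z_part_def by (simp add: prod.remove[of "set m" k])
  next
    case False
    then have "mult_part k m = 0"
      by (simp add: mult_part_def count_mset_0_iff)
    then show ?thesis
      using False by (simp add: z_part_def)
  qed
  then show ?thesis
    using * by simp
qed

lemma z_part_pos: "0 \<notin> set m \<Longrightarrow> 0 < z_part m"
  by (induction m) (auto simp: z_part_Cons, simp add: z_part_def)

text \<open>The first boson of \<open>m\<close> moves to the other side as its adjoint, where it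
  removes one \<open>r\<close> from \<open>m'\<close> with the factor \<open>r / 2\<close> times the
  multiplicity. Iterating pairs off the parts and accumulates \<open>z_part\<close>.\<close>

lemma fock_inner_fock_vec:
  assumes "\<forall>j\<in>set m. odd j" "\<forall>j\<in>set m'. odd j"
  shows "fock_inner (int (sum_list m)) (fock_vec m) (fock_vec m') =
     (if mset m = mset m' then real (z_part m) / 2 ^ length m else 0)"
  using assms
proof (induction m arbitrary: m')
  case Nil
  have "fock_inner 0 (ket {||}) (fock_vec m') = fock_vec m' {||}"
    by (simp add: fock_inner_def states_0 ket_def fcard_fempty)
  also have "\<dots> = (if m' = [] then 1 else 0)"
  proof (cases m')
    case (Cons j l)
    then have "{||} \<notin> states (int (sum_list m'))"
      using Nil.prems(2) odd_pos[of j] by (auto simp: states_def weight_def)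
    then show ?thesis
      using graded_fock_vec[of m'] Cons by (simp add: graded_def)
  qed (simp add: fock_vec_Nil ket_def)
  finally show ?case
    by (auto simp: fock_vec_Nil z_part_def)
next
  case (Cons r m)
  have r: "odd r" using Cons.prems by simp
  have "fock_inner (int (sum_list (r # m))) (fock_vec (r # m)) (fock_vec m') =
      fock_inner (int (sum_list m)) (fock_vec m) (boson (- int r) (fock_vec m'))"
    using r by (simp add: fock_vec_Cons fock_inner_boson)
  \<comment> \<open>The sum over a one-element set puts the scalar factor into the form of
    \<open>fock_inner_sum_right\<close>.\<close>
  also have "\<dots> = fock_inner (int (sum_list m)) (fock_vec m) (\<lambda>S. \<Sum>x\<in>{()}. (real r / 2 * real (mult_part r m')) * fock_vec (remove1 r m') S)"
    by (rule fock_inner_cong) (use boson_uminus_fock_vec[OF r Cons.prems(2)] in auto)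
  also have "\<dots> = real r / 2 * real (mult_part r m') * fock_inner (int (sum_list m)) (fock_vec m) (fock_vec (remove1 r m'))"
    by (subst fock_inner_sum_right) simp
  also have "\<dots> = real r / 2 * real (mult_part r m') *
      (if mset m = mset (remove1 r m') then real (z_part m) / 2 ^ length m else 0)"
  proof -
    have "\<forall>j\<in>set m. odd j" "\<forall>j\<in>set (remove1 r m'). odd j"
      using Cons.prems set_remove1_subset[of r m'] by auto
    then show ?thesis
      by (simp only: Cons.IH)
  qed
  also have "\<dots> = (if mset (r # m) = mset m' then real (z_part (r # m)) / 2 ^ length (r # m) else 0)"
  proof (cases "r \<in> set m'")
    case True
    then have "mset m' = add_mset r (mset (remove1 r m'))"
      by simp
    then have *: "mset (r # m) = mset m' \<longleftrightarrow> mset m = mset (remove1 r m')"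
      by (metis add_mset_add_single add_right_cancel mset.simps(2))
    show ?thesis
    proof (cases "mset m = mset (remove1 r m')")
      case eq: True
      then have "mult_part r m' = Suc (mult_part r m)"
        using * by (metis count_add_mset mset.simps(2) mult_part_def)
      then show ?thesis
        using * eq by (simp add: z_part_Cons algebra_simps)
    qed (use * in simp)
  next
    case False
    then have "mult_part r m' = 0" "mset (r # m) \<noteq> mset m'"
      using mset_eq_setD[of "r # m" m'] by (auto simp: mult_part_def)
    then show ?thesis
      by (simp only: of_nat_0 if_False)
  qed
  finally show ?case .
qed

section \<open>The boson of index 1 as addition of a box\<close>

text \<open>Adding a box, seen on the set of parts; \<open>k = 0\<close> stands for starting a new
  row.\<close>

definition raises :: "nat fset \<Rightarrow> nat fset \<Rightarrow> bool" where
  "raises T S \<longleftrightarrow> (\<exists>k. (k = 0 \<or> k |\<in>| T) \<and> \<not> Suc k |\<in>| T \<and> S = finsert (Suc k) (T |-| {|k|}))"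

definition lower :: "nat \<Rightarrow> nat fset \<Rightarrow> nat fset" where
  "lower k S = (if k = 0 then S |-| {|Suc k|} else finsert k (S |-| {|Suc k|}))"

text \<open>For positive \<open>k\<close> the sign at \<open>k\<close>, once \<open>Suc k\<close> is
  removed, equals the sign at \<open>Suc k\<close>, and the parity cancels the one in the
  annihilation. For \<open>k = 0\<close> the parity in \<open>phi 0\<close> counts the parts other
  than \<open>1\<close>, all of which lie above \<open>1\<close>.\<close>

lemma phi_pair:
  assumes "\<not> 0 |\<in>| S"
  shows "2 * (parity_sign (int k) * phi (1 + int k) (phi (- int k) f) S) =
     (if Suc k |\<in>| S \<and> \<not> k |\<in>| S then f (lower k S) else 0)"
proof (cases "k = 0")
  case True
  have "1 < j \<longleftrightarrow> j \<noteq> 0 \<and> j \<noteq> 1" for j :: nat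
    by auto
  then have "{j \<in> fset S. 1 < j} = fset (S |-| {|1|})"
    using assms by (simp only:) auto
  then have "above_sign 1 S = (-1) ^ fcard (S |-| {|1|})"
    unfolding above_sign_def fcard.rep_eq by simp
  then have "phi 0 f (S |-| {|1|}) = above_sign 1 S / 2 * f (S |-| {|1|})"
    by (simp only: phi_zero)
  then have "phi 1 (phi 0 f) S = (if 1 |\<in>| S then f (S |-| {|1|}) / 2 else 0)"
    using phi_pos[of 1 "phi 0 f" S] by (simp only:) simp
  then show ?thesis
    using True assms by (simp add: lower_def parity_sign_def)
next
  case False
  have "{j \<in> fset (S |-| {|Suc k|}). k < j} = {j \<in> fset S. Suc k < j}"
    by auto
  then have "above_sign k (S |-| {|Suc k|}) = above_sign (Suc k) S"
    by (simp add: above_sign_def)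
  then show ?thesis
    using False phi_pos[of "Suc k" "phi (- int k) f" S] by (simp add: phi_neg lower_def flip: mult.assoc)
qed

text \<open>The indices \<open>i\<close> and \<open>1 - i\<close> have opposite parity and their
  fermions anticommute, so both terms are equal. Twice the terms with \<open>i\<close> at most
  \<open>0\<close> remain, in the form of \<open>phi_pair\<close>.\<close>

lemma boson_1_aux:
  assumes "\<not> 0 |\<in>| S"
  shows "boson 1 f S = (\<Sum>k | Suc k |\<in>| S \<and> \<not> k |\<in>| S. f (lower k S))"
proof -
  define M where "M = 1 + weight S"
  let ?t = "\<lambda>i. parity_sign i * phi (1 - i) (phi i f) S"
  have sym: "?t (1 - i) = ?t i" for i
    using phi_anticommute[of i "1 - i" f S] by (simp add: parity_sign_def)
  \<comment> \<open>The range is extended by one index to be symmetric under replacing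
    \<open>i\<close> by \<open>1 - i\<close>.\<close>
  have "boson 1 f S = (\<Sum>i\<in>{- int M..int M + 1}. ?t i)"
    by (rule boson_eq) (auto simp: M_def)
  also have "{- int M..int M + 1} = {- int M..0} \<union> {1..int M + 1}"
    by auto
  also have "(\<Sum>i\<in>\<dots>. ?t i) = (\<Sum>i\<in>{- int M..0}. ?t i) + (\<Sum>i\<in>{1..int M + 1}. ?t i)"
    by (rule sum.union_disjoint) auto
  also have "(\<Sum>i\<in>{1..int M + 1}. ?t i) = (\<Sum>i\<in>{- int M..0}. ?t i)"
    by (rule sum.reindex_bij_witness[of _ "\<lambda>i. 1 - i" "\<lambda>i. 1 - i"]) (use sym in auto)
  also have "(\<Sum>i\<in>{- int M..0}. ?t i) = (\<Sum>k\<in>{..M}. ?t (- int k))"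
    by (rule sum.reindex_bij_witness[of _ "\<lambda>k. - int k" "\<lambda>i. nat (- i)"]) auto
  also have "\<dots> + \<dots> = (\<Sum>k\<in>{..M}. 2 * (parity_sign (int k) * phi (1 + int k) (phi (- int k) f) S))"
    by (simp add: sum_distrib_left)
  also have "\<dots> = (\<Sum>k\<in>{..M}. if Suc k |\<in>| S \<and> \<not> k |\<in>| S then f (lower k S) else 0)"
    by (simp only: phi_pair[OF assms])
  also have "\<dots> = (\<Sum>k\<in>{k \<in> {..M}. Suc k |\<in>| S \<and> \<not> k |\<in>| S}. f (lower k S))"
    by (rule sum.inter_filter[symmetric]) simp
  also have "{k \<in> {..M}. Suc k |\<in>| S \<and> \<not> k |\<in>| S} = {k. Suc k |\<in>| S \<and> \<not> k |\<in>| S}"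
    using le_weight[of _ S] by (force simp: M_def)
  finally show ?thesis .
qed

lemma mem_lower: "j |\<in>| lower k S \<longleftrightarrow> j |\<in>| S \<and> j \<noteq> Suc k \<or> k \<noteq> 0 \<and> j = k"
  by (auto simp: lower_def)

lemma inj_on_lower: "inj_on (\<lambda>k. lower k S) {k. Suc k |\<in>| S \<and> \<not> k |\<in>| S}"
proof (rule inj_onI, rule ccontr)
  fix k l
  assume kl: "k \<in> {k. Suc k |\<in>| S \<and> \<not> k |\<in>| S}" "k \<noteq> l"
    and eq: "lower k S = lower l S"
  from kl have "Suc k |\<in>| lower l S" "\<not> Suc k |\<in>| lower k S"
    by (auto simp: mem_lower)
  then show False
    using eq by simp
qed

lemma lower_image:
  assumes "\<not> 0 |\<in>| S"
  shows "(\<lambda>k. lower k S) ` {k. Suc k |\<in>| S \<and> \<not> k |\<in>| S} = {T. \<not> 0 |\<in>| T \<and> raises T S}"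
proof (intro subset_antisym subsetI)
  fix T assume "T \<in> (\<lambda>k. lower k S) ` {k. Suc k |\<in>| S \<and> \<not> k |\<in>| S}"
  then obtain k where k: "Suc k |\<in>| S" "\<not> k |\<in>| S" "T = lower k S"
    by auto
  have "S = finsert (Suc k) (lower k S |-| {|k|})"
    by (intro fset_eqI) (use k assms in \<open>auto simp: mem_lower\<close>)
  then show "T \<in> {T. \<not> 0 |\<in>| T \<and> raises T S}"
    unfolding raises_def k(3) mem_Collect_eq
    using k(1,2) assms by (intro conjI exI[of _ k]) (auto simp: mem_lower)
next
  fix T assume T: "T \<in> {T. \<not> 0 |\<in>| T \<and> raises T S}"
  then obtain k where k: "k = 0 \<or> k |\<in>| T" "\<not> Suc k |\<in>| T" "S = finsert (Suc k) (T |-| {|k|})"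
    by (auto simp: raises_def)
  have "T = lower k S"
    by (intro fset_eqI) (use k T in \<open>auto simp: mem_lower\<close>)
  then show "T \<in> (\<lambda>k. lower k S) ` {k. Suc k |\<in>| S \<and> \<not> k |\<in>| S}"
    using k by auto
qed

lemma raises_states:
  assumes "raises T S" "\<not> 0 |\<in>| T"
  shows "S \<in> states n \<longleftrightarrow> T \<in> states (n - 1)"
proof -
  obtain k where k: "k = 0 \<or> k |\<in>| T" "\<not> Suc k |\<in>| T" "S = finsert (Suc k) (T |-| {|k|})"
    using assms by (auto simp: raises_def)
  have "weight S = Suc (weight T)"
  proof (cases "k = 0")
    case True
    then have "T |-| {|k|} = T"
      using assms by auto
    then show ?thesis
      using k True by (simp add: weight_finsert)
  next
    case False
    then show ?thesis
      using k weight_fminus[of k T] by (simp add: weight_finsert)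
  qed
  moreover have "\<not> 0 |\<in>| S"
    using k assms by auto
  ultimately show ?thesis
    using assms by (auto simp: states_def)
qed

lemma boson_1:
  assumes "S \<in> states n"
  shows "boson 1 f S = (\<Sum>T\<in>{T \<in> states (n - 1). raises T S}. f T)"
proof -
  have S: "\<not> 0 |\<in>| S" using assms by (simp add: states_def)
  have "boson 1 f S = (\<Sum>T\<in>{T. \<not> 0 |\<in>| T \<and> raises T S}. f T)"
    unfolding boson_1_aux[OF S] lower_image[OF S, symmetric] sum.reindex[OF inj_on_lower] by simp
  also have "{T. \<not> 0 |\<in>| T \<and> raises T S} = {T \<in> states (n - 1). raises T S}"
    using raises_states[of _ S n] assms by (auto simp: states_def)
  finally show ?thesis .
qed

text \<open>Obtained from \<open>boson_1\<close> by adjointness; the powers of two are the ratio of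
  the weights in \<open>fock_inner\<close>.\<close>

lemma boson_uminus_1:
  assumes "T \<in> states (n - 1)"
  shows "boson (- 1) f T = (\<Sum>S\<in>{S \<in> states n. raises T S}. 2 ^ fcard T / 2 ^ fcard S * f S)"
proof -
  have "boson (- 1) f T / 2 ^ fcard T = fock_inner (n - 1) (ket T) (boson (- 1) f)"
    using assms by (simp add: fock_inner_def ket_def if_distrib[of "\<lambda>x. x * _"] if_distrib[of "\<lambda>x. x / _"] sum.delta' cong: if_cong)
  also have "\<dots> = fock_inner n (boson 1 (ket T)) f"
    using fock_inner_boson[of 1 n "ket T" f] by simp
  also have "\<dots> = (\<Sum>S\<in>states n. if raises T S then f S / 2 ^ fcard S else 0)"
    unfolding fock_inner_def
  proof (intro sum.cong refl)
    fix S assume "S \<in> states n"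
    then have "boson 1 (ket T) S = (\<Sum>U\<in>{U \<in> states (n - 1). raises U S}. if U = T then 1 else 0)"
      by (simp add: boson_1 ket_def)
    also have "\<dots> = (if raises T S then 1 else 0)"
      using assms by simp
    finally show "boson 1 (ket T) S * f S / 2 ^ fcard S = (if raises T S then f S / 2 ^ fcard S else 0)"
      by simp
  qed
  also have "\<dots> = (\<Sum>S\<in>{S \<in> states n. raises T S}. f S / 2 ^ fcard S)"
    by (simp add: sum.inter_filter)
  finally have "boson (- 1) f T = 2 ^ fcard T * (\<Sum>S\<in>{S \<in> states n. raises T S}. f S / 2 ^ fcard S)"
    by (simp add: field_simps)
  then show ?thesis
    by (simp add: sum_distrib_left)
qed

text \<open>The operator \<open>boson (- 1)\<close> takes out one factor \<open>boson 1\<close> with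
  half its multiplicity, and \<open>boson 1\<close> puts it back.\<close>

lemma boson_1_boson_uminus_1_fock_vec:
  assumes "\<forall>j\<in>set m. odd j"
  shows "boson 1 (boson (- 1) (fock_vec m)) S = real (mult_part 1 m) / 2 * fock_vec m S"
proof -
  have *: "boson (- 1) (fock_vec m) = (\<lambda>S. (real (mult_part 1 m) / 2) * fock_vec (remove1 1 m) S)"
  proof
    show "boson (- 1) (fock_vec m) S = real (mult_part 1 m) / 2 * fock_vec (remove1 1 m) S" for S
      using boson_uminus_fock_vec[of 1 m S] assms by simp
  qed
  have "boson 1 (boson (- 1) (fock_vec m)) S = real (mult_part 1 m) / 2 * fock_vec (1 # remove1 1 m) S"
    unfolding * boson_scale by (simp add: fock_vec_Cons)
  also have "\<dots> = real (mult_part 1 m) / 2 * fock_vec m S"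
  proof (cases "1 \<in> set m")
    case True
    show ?thesis
      by (simp only: fock_vec_remove1[OF True assms])
  next
    case False
    then have "mult_part 1 m = 0"
      by (simp add: mult_part_def count_mset_0_iff)
    then show ?thesis
      by (simp only: of_nat_0)
  qed
  finally show ?thesis .
qed

section \<open>Raising operators on symmetric functions\<close>

text \<open>These are the factors \<open>(x i - t * x j) / (x i - x j)\<close> of the
  Hall-Littlewood formula at \<open>t = -1\<close>.\<close>

definition schur_kernel :: "(nat \<Rightarrow> real) \<Rightarrow> nat \<Rightarrow> nat set \<Rightarrow> real" where
  "schur_kernel x i C = (\<Prod>j\<in>C. (x i + x j) / (x i - x j))"

text \<open>Functions depend on an index set of variables rather than on a number of variables,
  since the raised variable is withdrawn from those left to \<open>h\<close>.\<close>

definition raise_op :: "(nat \<Rightarrow> real) \<Rightarrow> nat \<Rightarrow> (nat set \<Rightarrow> real) \<Rightarrow> nat set \<Rightarrow> real" where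
  "raise_op x k h A = (\<Sum>i\<in>A. x i ^ k * schur_kernel x i (A - {i}) * h (A - {i}))"

lemma schur_kernel_remove:
  "finite C \<Longrightarrow> j \<in> C \<Longrightarrow> schur_kernel x i C = (x i + x j) / (x i - x j) * schur_kernel x i (C - {j})"
  unfolding schur_kernel_def by (rule prod.remove)

lemma sum_swap_offdiag:
  assumes "finite A"
  shows "(\<Sum>i\<in>A. \<Sum>j\<in>A - {i}. T i j) = (\<Sum>i\<in>A. \<Sum>j\<in>A - {i}. (T j i :: real))"
proof -
  have "(\<Sum>i\<in>A. \<Sum>j\<in>A - {i}. T i j) = (\<Sum>i\<in>A. \<Sum>j\<in>A. if j \<noteq> i then T i j else 0)" for T :: "'a \<Rightarrow> 'a \<Rightarrow> real"
    using assms by (intro sum.cong refl sum.mono_neutral_cong_left) auto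
  note * = this
  show ?thesis
    unfolding * by (subst sum.swap) (intro sum.cong refl, auto)
qed

lemma raise_op_raise_op:
  "raise_op x k (raise_op x l h) A = (\<Sum>i\<in>A. \<Sum>j\<in>A - {i}. x i ^ k * x j ^ l *
     (schur_kernel x i (A - {i}) * schur_kernel x j (A - {i} - {j})) * h (A - {i} - {j}))"
  by (simp add: raise_op_def sum_distrib_left sum_distrib_right mult_ac)

text \<open>Exchanging the roles of the two chosen variables changes only the factor between them,
  \<open>(x i + x j) / (x i - x j)\<close>, and that by a sign.\<close>

lemma raise_op_anticommute:
  "raise_op x k (raise_op x l h) A = - raise_op x l (raise_op x k h) A"
proof (cases "finite A")
  case True
  have "raise_op x k (raise_op x l h) A = (\<Sum>i\<in>A. \<Sum>j\<in>A - {i}. x j ^ k * x i ^ l *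
     (schur_kernel x j (A - {j}) * schur_kernel x i (A - {j} - {i})) * h (A - {j} - {i}))"
    unfolding raise_op_raise_op by (rule sum_swap_offdiag[OF True])
  also have "\<dots> = (\<Sum>i\<in>A. \<Sum>j\<in>A - {i}. - (x i ^ l * x j ^ k *
     (schur_kernel x i (A - {i}) * schur_kernel x j (A - {i} - {j})) * h (A - {i} - {j})))"
  proof (intro sum.cong refl)
    fix i j assume ij: "i \<in> A" "j \<in> A - {i}"
    have swap: "A - {j} - {i} = A - {i} - {j}"
      by auto
    have "schur_kernel x j (A - {j}) = (x j + x i) / (x j - x i) * schur_kernel x j (A - {i} - {j})"
      "schur_kernel x i (A - {i}) = (x i + x j) / (x i - x j) * schur_kernel x i (A - {i} - {j})"
      using schur_kernel_remove[of "A - {j}" i x j] schur_kernel_remove[of "A - {i}" j x i] ij True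
      unfolding swap by auto
    moreover have "(x j + x i) / (x j - x i) = - ((x i + x j) / (x i - x j))"
      by (metis add.commute minus_diff_eq minus_divide_right)
    ultimately show "x j ^ k * x i ^ l * (schur_kernel x j (A - {j}) * schur_kernel x i (A - {j} - {i})) * h (A - {j} - {i}) =
       - (x i ^ l * x j ^ k * (schur_kernel x i (A - {i}) * schur_kernel x j (A - {i} - {j})) * h (A - {i} - {j}))"
      unfolding swap by (simp add: mult_ac)
  qed
  also have "\<dots> = - raise_op x l (raise_op x k h) A"
    unfolding raise_op_raise_op by (simp add: sum_negf)
  finally show ?thesis .
qed (simp add: raise_op_def)

lemma raise_op_cong:
  "A = A' \<Longrightarrow> (\<And>i. i \<in> A' \<Longrightarrow> h (A' - {i}) = h' (A' - {i})) \<Longrightarrow> raise_op x k h A = raise_op x k h' A'"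
  by (simp add: raise_op_def)

lemma raise_op_sum:
  "raise_op x k (\<lambda>A. \<Sum>s\<in>X. c s * h s A) A = (\<Sum>s\<in>X. c s * raise_op x k (h s) A)"
  unfolding raise_op_def sum_distrib_left by (subst sum.swap) (simp add: mult_ac)

lemma raise_op_scale: "raise_op x k (\<lambda>A. c * h A) A = c * raise_op x k h A"
  by (simp add: raise_op_def sum_distrib_left mult_ac)

section \<open>Power sums in terms of raising operators\<close>

definition psum :: "(nat \<Rightarrow> real) \<Rightarrow> nat \<Rightarrow> nat set \<Rightarrow> real" where
  "psum x r A = (\<Sum>i\<in>A. x i ^ r)"

text \<open>The share of the chosen variable in the power sum raises its exponent further, and the
  remaining variables act on \<open>h\<close>. This is the counterpart of
  \<open>boson_phi\<close>.\<close>

lemma psum_raise_op: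
  assumes "finite A"
  shows "psum x r A * raise_op x k h A = raise_op x (k + r) h A + raise_op x k (\<lambda>A. psum x r A * h A) A"
proof -
  have "psum x r A = x i ^ r + psum x r (A - {i})" if "i \<in> A" for i
    using that assms by (simp add: psum_def sum.remove)
  then have "psum x r A * raise_op x k h A =
     (\<Sum>i\<in>A. (x i ^ r + psum x r (A - {i})) * (x i ^ k * schur_kernel x i (A - {i}) * h (A - {i})))"
    unfolding raise_op_def sum_distrib_left by (intro sum.cong) auto
  then show ?thesis
    by (simp add: raise_op_def algebra_simps sum.distrib power_add)
qed

lemma degree_diff_monic:
  fixes p q :: "'a :: comm_ring_1 poly"
  assumes "degree p = n" "degree q = n" "lead_coeff p = 1" "lead_coeff q = 1" "0 < n"
  shows "degree (p - q) < n"
proof -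
  have "degree (p - q) \<le> n - 1"
  proof (rule degree_le, intro allI impI)
    fix i assume "n - 1 < i"
    then have "i = n \<or> n < i" by linarith
    then show "coeff (p - q) i = 0"
      using assms by (auto simp: coeff_eq_0)
  qed
  then show ?thesis using assms(5) by linarith
qed

text \<open>Both sides are polynomials in \<open>y\<close> of degree less than \<open>card B\<close>; they agree at the points \<open>- x a\<close>.\<close>

lemma schur_kernel_interpolation:
  assumes "finite B" "inj_on x B"
  shows "(\<Sum>a\<in>B. 2 * x a * schur_kernel x a (B - {a}) * (\<Prod>m\<in>B - {a}. y + x m)) =
     (\<Prod>m\<in>B. y + x m) - (\<Prod>m\<in>B. y - x m)"
proof (cases "B = {}")
  case False
  let ?p = "\<Sum>a\<in>B. smult (2 * x a * schur_kernel x a (B - {a})) (\<Prod>m\<in>B - {a}. [:x m, 1:])"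
  let ?q1 = "\<Prod>m\<in>B. [:x m, 1:]" and ?q2 = "\<Prod>m\<in>B. [:- x m, 1:]"
  have card: "0 < card B"
    using False assms by (simp add: card_gt_0_iff)
  have deg: "degree (\<Prod>m\<in>C. [:f m, 1:]) = card C" for C and f :: "nat \<Rightarrow> real"
    by (subst degree_prod_eq_sum_degree) auto
  have lc: "lead_coeff (\<Prod>m\<in>C. [:f m, 1:]) = 1" for C and f :: "nat \<Rightarrow> real"
    by (simp only: lead_coeff_prod) simp
  have "degree (?q1 - ?q2) < card B"
    by (rule degree_diff_monic[OF deg deg lc lc card])
  moreover have "degree ?p < card B"
  proof (rule degree_sum_less)
    fix a assume "a \<in> B"
    then have "card (B - {a}) < card B"
      using assms card by simp
    then show "degree (smult (2 * x a * schur_kernel x a (B - {a})) (\<Prod>m\<in>B - {a}. [:x m, 1:])) < card B"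
      using degree_smult_le[of _ "\<Prod>m\<in>B - {a}. [:x m, 1:]"] deg[of x "B - {a}"] by (metis le_less_trans)
  qed (rule card)
  moreover have "card ((\<lambda>a. - x a) ` B) = card B"
    using assms(2) by (intro card_image) (auto simp: inj_on_def)
  moreover have "poly ?p z = poly (?q1 - ?q2) z" if z: "z \<in> (\<lambda>a. - x a) ` B" for z
  proof -
    obtain b where b: "b \<in> B" "z = - x b" using z by auto
    have "poly ?p z = (\<Sum>a\<in>B. 2 * x a * schur_kernel x a (B - {a}) * (\<Prod>m\<in>B - {a}. x m - x b))"
      by (simp add: poly_sum poly_prod b)
    also have "\<dots> = (\<Sum>a\<in>B. if a = b then 2 * x b * schur_kernel x b (B - {b}) * (\<Prod>m\<in>B - {b}. x m - x b) else 0)"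
    proof (intro sum.cong refl)
      fix a assume "a \<in> B"
      have "(\<Prod>m\<in>B - {a}. x m - x b) = 0" if "a \<noteq> b"
        using that b assms by (intro prod_zero) auto
      then show "2 * x a * schur_kernel x a (B - {a}) * (\<Prod>m\<in>B - {a}. x m - x b) =
        (if a = b then 2 * x b * schur_kernel x b (B - {b}) * (\<Prod>m\<in>B - {b}. x m - x b) else 0)"
        by auto
    qed
    also have "\<dots> = 2 * x b * (schur_kernel x b (B - {b}) * (\<Prod>m\<in>B - {b}. x m - x b))"
      using b assms by simp
    also have "schur_kernel x b (B - {b}) * (\<Prod>m\<in>B - {b}. x m - x b) = (\<Prod>m\<in>B - {b}. - x b - x m)"
      unfolding schur_kernel_def prod.distrib[symmetric]
    proof (intro prod.cong refl)
      fix m assume "m \<in> B - {b}"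
      then have "x b \<noteq> x m"
        using assms(2) b by (auto dest: inj_onD)
      then show "(x b + x m) / (x b - x m) * (x m - x b) = - x b - x m"
        by (simp add: divide_simps) (simp add: algebra_simps)
    qed
    also have "2 * x b * (\<Prod>m\<in>B - {b}. - x b - x m) = - (\<Prod>m\<in>B. - x b - x m)"
      using prod.remove[of B b "\<lambda>m. - x b - x m"] b assms by simp
    also have "(\<Prod>m\<in>B. x m - x b) = 0"
      using b assms by (intro prod_zero) auto
    then have "- (\<Prod>m\<in>B. - x b - x m) = poly (?q1 - ?q2) z"
      by (simp add: poly_prod b minus_diff_commute)
    finally show ?thesis .
  qed
  ultimately have "?p = ?q1 - ?q2"
    by (intro poly_eqI_degree[of "(\<lambda>a. - x a) ` B"]) auto
  then have "poly ?p y = poly (?q1 - ?q2) y"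
    by simp
  then show ?thesis
    by (simp add: poly_sum poly_prod add.commute)
qed simp

text \<open>The factor \<open>u + v\<close> makes the geometric sum telescope, and odd
  \<open>r\<close> fixes the sign of the last term.\<close>

lemma sum_alternating_telescope:
  fixes u v :: real
  assumes "odd r"
  shows "(u + v) * (\<Sum>i\<in>{1..<r}. parity_sign (int i) * (u ^ (r - i) * v ^ i)) = u * v ^ r - u ^ r * v"
proof -
  let ?w = "\<lambda>i. - (parity_sign (int i) * u ^ (Suc r - i) * v ^ i)"
  have "(u + v) * (\<Sum>i\<in>{1..<r}. parity_sign (int i) * (u ^ (r - i) * v ^ i)) = (\<Sum>i\<in>{1..<r}. ?w (Suc i) - ?w i)"
    unfolding sum_distrib_left
    by (intro sum.cong) (auto simp: parity_sign_def Suc_diff_le algebra_simps)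
  also have "\<dots> = ?w r - ?w 1"
    by (rule sum_Suc_diff') (use assms odd_pos[of r] in auto)
  finally show ?thesis
    using assms by (simp add: parity_sign_def)
qed

text \<open>The counterpart of \<open>boson_ket_empty\<close>. Telescoping over \<open>i\<close>
  turns the contribution of each pair of variables into \<open>?T a b + ?T b a\<close>. After
  symmetrisation the sum over \<open>a\<close> for fixed \<open>b\<close> is evaluated by
  \<open>schur_kernel_interpolation\<close>.\<close>

lemma psum_expansion:
  assumes "odd r" "finite A" "inj_on x A"
  shows "psum x r A = raise_op x r (\<lambda>_. 1) A +
     (\<Sum>i\<in>{1..<r}. parity_sign (int i) * raise_op x (r - i) (raise_op x i (\<lambda>_. 1)) A)"
proof -
  let ?C = "\<lambda>a b. A - {a} - {b}"
  let ?K = "\<lambda>a b. schur_kernel x a (?C a b) * schur_kernel x b (?C a b)"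
  let ?T = "\<lambda>a b. x a * x b ^ r / (x a - x b) * ?K a b"
  have C_swap: "?C a b = ?C b a" for a b by auto
  have "(\<Sum>i\<in>{1..<r}. parity_sign (int i) * raise_op x (r - i) (raise_op x i (\<lambda>_. 1)) A) =
      (\<Sum>i\<in>{1..<r}. \<Sum>a\<in>A. \<Sum>b\<in>A - {a}. parity_sign (int i) * (x a ^ (r - i) * x b ^ i) * (schur_kernel x a (A - {a}) * schur_kernel x b (?C a b)))"
    unfolding raise_op_raise_op by (simp add: sum_distrib_left mult_ac)
  also have "\<dots> = (\<Sum>a\<in>A. \<Sum>b\<in>A - {a}. \<Sum>i\<in>{1..<r}. parity_sign (int i) * (x a ^ (r - i) * x b ^ i) * (schur_kernel x a (A - {a}) * schur_kernel x b (?C a b)))"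
    by (subst sum.swap, rule sum.cong[OF refl], rule sum.swap)
  also have "\<dots> = (\<Sum>a\<in>A. \<Sum>b\<in>A - {a}. ?T a b + ?T b a)"
  proof (intro sum.cong refl)
    fix a b assume ab: "a \<in> A" "b \<in> A - {a}"
    then have ne: "x a - x b \<noteq> 0"
      using assms(3) by (auto dest: inj_onD)
    have "(\<Sum>i\<in>{1..<r}. parity_sign (int i) * (x a ^ (r - i) * x b ^ i) * (schur_kernel x a (A - {a}) * schur_kernel x b (?C a b))) =
      (\<Sum>i\<in>{1..<r}. parity_sign (int i) * (x a ^ (r - i) * x b ^ i)) * ((x a + x b) / (x a - x b) * ?K a b)"
    proof -
      have "schur_kernel x a (A - {a}) = (x a + x b) / (x a - x b) * schur_kernel x a (?C a b)"
        using ab assms by (intro schur_kernel_remove) auto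
      then show ?thesis
        by (simp only: sum_distrib_right mult.assoc)
    qed
    also have "\<dots> = (x a + x b) * (\<Sum>i\<in>{1..<r}. parity_sign (int i) * (x a ^ (r - i) * x b ^ i)) / (x a - x b) * ?K a b"
      by simp
    also have "\<dots> = (x a * x b ^ r - x a ^ r * x b) / (x a - x b) * ?K a b"
      by (simp only: sum_alternating_telescope[OF assms(1)])
    also have "\<dots> = (x a * x b ^ r / (x a - x b) + x b * x a ^ r / (x b - x a)) * ?K a b"
    proof -
      have "x b - x a = - (x a - x b)" by simp
      then show ?thesis
        using ne by (simp only: divide_minus_right) (simp add: diff_divide_distrib mult.commute)
    qed
    also have "\<dots> = ?T a b + ?T b a"
      unfolding C_swap[of b a] by (simp add: algebra_simps)
    finally show "(\<Sum>i\<in>{1..<r}. parity_sign (int i) * (x a ^ (r - i) * x b ^ i) * (schur_kernel x a (A - {a}) * schur_kernel x b (?C a b))) = ?T a b + ?T b a" .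
  qed
  also have "\<dots> = (\<Sum>a\<in>A. \<Sum>b\<in>A - {a}. ?T a b) + (\<Sum>a\<in>A. \<Sum>b\<in>A - {a}. ?T b a)"
    by (simp only: sum.distrib)
  also have "(\<Sum>a\<in>A. \<Sum>b\<in>A - {a}. ?T a b) = (\<Sum>a\<in>A. \<Sum>b\<in>A - {a}. ?T b a)"
    by (rule sum_swap_offdiag[OF assms(2)])
  also have "(\<Sum>b\<in>A. \<Sum>a\<in>A - {b}. ?T a b) + (\<Sum>b\<in>A. \<Sum>a\<in>A - {b}. ?T a b) =
      (\<Sum>b\<in>A. \<Sum>a\<in>A - {b}. 2 * ?T a b)"
    by (simp add: sum_distrib_left)
  also have "\<dots> = (\<Sum>b\<in>A. x b ^ r - x b ^ r * schur_kernel x b (A - {b}))"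
  proof (intro sum.cong refl)
    fix b assume b: "b \<in> A"
    let ?D = "\<Prod>m\<in>A - {b}. x b - x m"
    have D0: "?D \<noteq> 0"
      using assms b by (auto dest: inj_onD)
    have "(\<Sum>a\<in>A - {b}. 2 * ?T a b) = (\<Sum>a\<in>A - {b}. - (x b ^ r / ?D) *
        (2 * x a * schur_kernel x a (A - {b} - {a}) * (\<Prod>m\<in>A - {b} - {a}. x b + x m)))"
    proof (intro sum.cong refl)
      fix a assume a: "a \<in> A - {b}"
      have D: "?D = - ((x a - x b) * (\<Prod>m\<in>A - {b} - {a}. x b - x m))"
        using a assms by (simp add: prod.remove[of "A - {b}" a] minus_mult_left)
      show "2 * ?T a b = - (x b ^ r / ?D) *
        (2 * x a * schur_kernel x a (A - {b} - {a}) * (\<Prod>m\<in>A - {b} - {a}. x b + x m))"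
        unfolding D C_swap[of a b] schur_kernel_def[of x b] prod_dividef
        by (simp add: mult_ac)
    qed
    \<comment> \<open>Interpolation over \<open>A - {b}\<close> at the point \<open>y = x b\<close>;
      the second product there is \<open>?D\<close>.\<close>
    also have "\<dots> = - (x b ^ r / ?D) * ((\<Prod>m\<in>A - {b}. x b + x m) - ?D)"
      unfolding sum_distrib_left[symmetric] using assms
      by (subst schur_kernel_interpolation) (auto intro: inj_on_subset)
    also have "\<dots> = x b ^ r - x b ^ r * schur_kernel x b (A - {b})"
      using D0 by (simp add: schur_kernel_def prod_dividef field_simps)
    finally show "(\<Sum>a\<in>A - {b}. 2 * ?T a b) = x b ^ r - x b ^ r * schur_kernel x b (A - {b})" .
  qed
  finally show ?thesis
    by (simp add: psum_def raise_op_def sum_subtractf)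
qed

section \<open>From the Fock space to functions\<close>

text \<open>The largest part is raised outermost, as in the decreasing wedge product. Starting from
  the constant \<open>1\<close> leaves the remaining variables with exponent zero and without
  factors among themselves.\<close>

definition Pfun :: "(nat \<Rightarrow> real) \<Rightarrow> nat fset \<Rightarrow> nat set \<Rightarrow> real" where
  "Pfun x S = foldr (raise_op x) (rev (sorted_list_of_set (fset S))) (\<lambda>_. 1)"

lemma Pfun_empty: "Pfun x {||} = (\<lambda>_. 1)"
  by (simp add: Pfun_def)

lemma Pfun_insert_max:
  assumes "\<And>j. j |\<in>| S \<Longrightarrow> j < k"
  shows "Pfun x (finsert k S) = raise_op x k (Pfun x S)"
proof -
  have "sorted_list_of_set (fset (finsert k S)) = sorted_list_of_set (fset S) @ [k]"
    using sorted_list_of_set.idem_if_sorted_distinct[of "sorted_list_of_set (fset S) @ [k]"] assms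
    by (fastforce simp: sorted_append less_imp_le)
  then show ?thesis
    by (simp add: Pfun_def)
qed

text \<open>Straightening: raising operators anticommute and square to zero, so a part moves past
  the larger ones into its place with the same sign as in the Fock space.\<close>

lemma raise_op_Pfun:
  "raise_op x k (Pfun x S) A = (if k |\<in>| S then 0 else above_sign k S * Pfun x (finsert k S) A)"
proof (induction S arbitrary: A rule: fset_max_induct)
  case empty
  then show ?case
    using Pfun_insert_max[of "{||}" k x] by (simp add: above_sign_def)
next
  case (insert m S)
  have m: "Pfun x (finsert m S) = raise_op x m (Pfun x S)"
    using insert(1) by (rule Pfun_insert_max)
  consider "k < m" | "k = m" | "m < k" by linarith
  then show ?case
  proof cases
    case 1
    have "raise_op x k (Pfun x (finsert m S)) A = - raise_op x m (raise_op x k (Pfun x S)) A"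
      unfolding m by (rule raise_op_anticommute)
    also have "raise_op x m (raise_op x k (Pfun x S)) A =
        raise_op x m (\<lambda>A. (if k |\<in>| S then 0 else above_sign k S) * Pfun x (finsert k S) A) A"
      by (rule raise_op_cong) (auto simp: insert(2))
    also have "\<dots> = (if k |\<in>| S then 0 else above_sign k S) * raise_op x m (Pfun x (finsert k S)) A"
      by (rule raise_op_scale)
    also have "raise_op x m (Pfun x (finsert k S)) = Pfun x (finsert m (finsert k S))"
      using insert(1) 1 by (intro Pfun_insert_max[symmetric]) auto
    also have "finsert m (finsert k S) = finsert k (finsert m S)"
      by auto
    finally have "raise_op x k (Pfun x (finsert m S)) A =
        - ((if k |\<in>| S then 0 else above_sign k S) * Pfun x (finsert k (finsert m S)) A)" .
    moreover have "\<not> m |\<in>| S"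
      using insert(1) by blast
    ultimately show ?thesis
      using 1 above_sign_toggle[of k m S] by (auto simp: toggle_def)
  next
    case 2
    have "raise_op x m (raise_op x m (Pfun x S)) A = 0"
      using raise_op_anticommute[of x m m "Pfun x S" A] by linarith
    then show ?thesis
      using 2 m by simp
  next
    case 3
    have less: "j < k" if "j |\<in>| finsert m S" for j
      using that insert(1)[of j] 3 by auto
    then have "\<not> k |\<in>| finsert m S" "above_sign k (finsert m S) = 1"
      using above_sign_max[of "finsert m S" k] less_imp_le by blast+
    moreover have "Pfun x (finsert k (finsert m S)) = raise_op x k (Pfun x (finsert m S))"
      by (rule Pfun_insert_max) (rule less)
    ultimately show ?thesis
      by simp
  qed
qed

text \<open>The realisation of vectors of degree \<open>n\<close> as functions. It turns creations
  into raising operators and positive odd bosons into multiplication by power sums.\<close>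

definition eval_state :: "(nat \<Rightarrow> real) \<Rightarrow> int \<Rightarrow> (nat fset \<Rightarrow> real) \<Rightarrow> nat set \<Rightarrow> real" where
  "eval_state x n f A = (\<Sum>S\<in>states n. f S * Pfun x S A)"

lemma eval_state_phi:
  assumes "0 < k"
  shows "eval_state x (n + int k) (phi (int k) f) A = raise_op x k (eval_state x n f) A"
proof -
  have above: "above_sign k (finsert k T) = above_sign k T" if "\<not> k |\<in>| T" for T
    using that above_sign_toggle[of k k T] by (simp add: toggle_def)
  have "eval_state x (n + int k) (phi (int k) f) A =
      (\<Sum>S\<in>states (n + int k). if k |\<in>| S then above_sign k S * f (S |-| {|k|}) * Pfun x S A else 0)"
    unfolding eval_state_def using assms by (intro sum.cong) (auto simp: phi_pos)
  also have "\<dots> = (\<Sum>T\<in>states n. if k |\<in>| T then 0 else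
      above_sign k (finsert k T) * f (finsert k T |-| {|k|}) * Pfun x (finsert k T) A)"
    by (rule sum_states_insert[OF assms])
  also have "\<dots> = (\<Sum>T\<in>states n. f T * raise_op x k (Pfun x T) A)"
  proof (intro sum.cong refl)
    fix T
    have "k |\<notin>| T \<Longrightarrow> finsert k T |-| {|k|} = T"
      by auto
    then show "(if k |\<in>| T then 0 else
      above_sign k (finsert k T) * f (finsert k T |-| {|k|}) * Pfun x (finsert k T) A) =
      f T * raise_op x k (Pfun x T) A"
      by (auto simp: raise_op_Pfun above)
  qed
  also have "\<dots> = raise_op x k (eval_state x n f) A"
    unfolding eval_state_def[abs_def] by (rule raise_op_sum[symmetric])
  finally show ?thesis .
qed

lemma eval_state_ket: "S \<in> states n \<Longrightarrow> eval_state x n (ket S) = Pfun x S"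
  by (simp add: eval_state_def ket_def fun_eq_iff if_distrib[of "\<lambda>y. y * _"] sum.delta' cong: if_cong)

lemma eval_state_add: "eval_state x n (\<lambda>S. f S + g S) A = eval_state x n f A + eval_state x n g A"
  by (simp add: eval_state_def algebra_simps sum.distrib)

lemma eval_state_sum:
  "eval_state x n (\<lambda>S. \<Sum>s\<in>X. c s * f s S) A = (\<Sum>s\<in>X. c s * eval_state x n (f s) A)"
  unfolding eval_state_def sum_distrib_left sum_distrib_right
  by (subst sum.swap) (simp add: mult_ac)

text \<open>On the vacuum, \<open>boson_ket_empty\<close> and \<open>psum_expansion\<close> have the
  same shape. When a new largest part is added, \<open>boson_phi\<close> matches
  \<open>psum_raise_op\<close>; the induction hypothesis is then applied with one variable
  removed.\<close>

lemma eval_state_boson_ket: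
  assumes "odd r" "S \<in> states n" "finite A" "inj_on x A"
  shows "eval_state x (n + int r) (boson (int r) (ket S)) A = psum x r A * Pfun x S A"
  using assms(2-4)
proof (induction S arbitrary: n A rule: fset_max_induct)
  case empty
  have r: "0 < r" using assms(1) by (rule odd_pos)
  have n: "n = 0" using empty by (simp add: states_def weight_def)
  have one: "eval_state x 0 (ket {||}) = (\<lambda>_. 1)"
    by (simp add: eval_state_ket states_0 Pfun_empty)
  have 1: "eval_state x (int k) (phi (int k) (ket {||})) = raise_op x k (\<lambda>_. 1)" if "0 < k" for k
    using eval_state_phi[OF that, of x 0 "ket {||}"] by (simp add: one fun_eq_iff)
  have 2: "eval_state x (int r) (phi (int (r - i)) (phi (int i) (ket {||}))) A =
      raise_op x (r - i) (raise_op x i (\<lambda>_. 1)) A" if "i \<in> {1..<r}" for i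
  proof -
    have "int r = int i + int (r - i)"
      using that by simp
    then have "eval_state x (int r) (phi (int (r - i)) (phi (int i) (ket {||}))) A =
       raise_op x (r - i) (eval_state x (int i) (phi (int i) (ket {||}))) A"
      using eval_state_phi[of "r - i" x "int i"] that by (metis atLeastLessThan_iff zero_less_diff)
    then show ?thesis
      using 1[of i] that by simp
  qed
  have "eval_state x (n + int r) (boson (int r) (ket {||})) A = raise_op x r (\<lambda>_. 1) A +
     (\<Sum>i\<in>{1..<r}. parity_sign (int i) * raise_op x (r - i) (raise_op x i (\<lambda>_. 1)) A)"
    unfolding boson_ket_empty[OF assms(1) r, abs_def] n add_0 eval_state_add eval_state_sum 1[OF r]
    by (simp only: 2 cong: sum.cong)
  then show ?case
    using psum_expansion[OF assms(1) empty(2,3)] by (simp add: Pfun_empty)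
next
  case (insert k S)
  have k: "0 < k" "\<not> k |\<in>| S"
    using insert by (auto simp: states_def intro!: gr0I)
  have S: "S \<in> states (n - int k)"
    using insert.prems(1) states_finsert[OF k, of "n - int k"] by simp
  have ket: "ket (finsert k S) = phi (int k) (ket S)"
    using insert(1) k by (intro ket_insert_max) auto
  have "boson (int r) (ket (finsert k S)) = (\<lambda>T. phi (int k) (boson (int r) (ket S)) T + phi (int (k + r)) (ket S) T)"
    unfolding ket using assms(1) by (simp add: boson_phi')
  then have "eval_state x (n + int r) (boson (int r) (ket (finsert k S))) A =
     eval_state x (n + int r) (phi (int k) (boson (int r) (ket S))) A +
     eval_state x (n + int r) (phi (int (k + r)) (ket S)) A"
    by (simp only: eval_state_add)
  also have "eval_state x (n + int r) (phi (int k) (boson (int r) (ket S))) A =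
      raise_op x k (eval_state x (n - int k + int r) (boson (int r) (ket S))) A"
    using eval_state_phi[OF k(1), of x "n - int k + int r"] by simp
  also have "\<dots> = raise_op x k (\<lambda>A. psum x r A * Pfun x S A) A"
    using S insert.prems by (intro raise_op_cong refl insert.IH) (auto intro: inj_on_subset)
  also have "eval_state x (n + int r) (phi (int (k + r)) (ket S)) A = raise_op x (k + r) (Pfun x S) A"
    using eval_state_phi[of "k + r" x "n - int k" "ket S" A] k eval_state_ket[OF S] by simp
  also have "raise_op x k (\<lambda>A. psum x r A * Pfun x S A) A + raise_op x (k + r) (Pfun x S) A =
      psum x r A * raise_op x k (Pfun x S) A"
    using psum_raise_op[OF insert.prems(2)] by simp
  also have "raise_op x k (Pfun x S) = Pfun x (finsert k S)"
    using insert(1) by (rule Pfun_insert_max[symmetric])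
  finally show ?case .
qed

lemma eval_state_boson:
  assumes "odd r" "graded n f" "finite A" "inj_on x A"
  shows "eval_state x (n + int r) (boson (int r) f) A = psum x r A * eval_state x n f A"
proof -
  have "boson (int r) f = boson (int r) (\<lambda>T. \<Sum>S\<in>states n. f S * ket S T)"
    using graded_expand[OF assms(2)] by simp
  then have "eval_state x (n + int r) (boson (int r) f) A =
      (\<Sum>S\<in>states n. f S * eval_state x (n + int r) (boson (int r) (ket S)) A)"
    by (simp only: boson_sum' eval_state_sum)
  also have "\<dots> = (\<Sum>S\<in>states n. psum x r A * (f S * Pfun x S A))"
    using assms by (intro sum.cong) (auto simp: eval_state_boson_ket)
  finally show ?thesis
    by (simp add: eval_state_def sum_distrib_left)
qed

lemma eval_state_fock_vec:
  assumes "\<forall>j\<in>set m. odd j" "finite A" "inj_on x A"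
  shows "eval_state x (int (sum_list m)) (fock_vec m) A = (\<Prod>k\<leftarrow>m. psum x k A)"
  using assms(1)
proof (induction m)
  case Nil
  then show ?case
    by (simp add: fock_vec_Nil eval_state_ket states_0 Pfun_empty)
next
  case (Cons k m)
  then show ?case
    using eval_state_boson[OF _ graded_fock_vec assms(2,3), of k m] by (simp add: fock_vec_Cons add.commute)
qed

section \<open>Hall--Littlewood functions at \<open>t = -1\<close>\<close>

text \<open>Exponents are functions on an index set instead of words, so that a variable can be
  removed without renumbering the others.\<close>

definition arrangements :: "nat set \<Rightarrow> nat multiset \<Rightarrow> (nat \<Rightarrow> nat) set" where
  "arrangements A M = {a \<in> A \<rightarrow>\<^sub>E UNIV. filter_mset (\<lambda>k. 0 < k) (image_mset a (mset_set A)) = M}"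

definition arr_weight :: "(nat \<Rightarrow> real) \<Rightarrow> nat set \<Rightarrow> (nat \<Rightarrow> nat) \<Rightarrow> real" where
  "arr_weight x A a = (\<Prod>i\<in>A. x i ^ a i) *
     (\<Prod>(i, j)\<in>{(i, j). i \<in> A \<and> j \<in> A \<and> a j < a i}. (x i + x j) / (x i - x j))"

lemma arrangements_value:
  assumes "a \<in> arrangements A M" "finite A" "i \<in> A"
  shows "a i = 0 \<or> a i \<in># M"
proof -
  have "a i \<in># image_mset a (mset_set A)"
    using assms by simp
  then show ?thesis
    using assms(1) by (auto simp: arrangements_def)
qed

lemma filter_image_mset_remove:
  assumes "finite A" "i \<in> A"
  shows "filter_mset P (image_mset a (mset_set A)) =
    (if P (a i) then {#a i#} else {#}) + filter_mset P (image_mset a (mset_set (A - {i})))"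
  using assms by (simp add: mset_set.remove)

text \<open>Every pair that involves the index of the strictly largest exponent has it in first
  position, and the factors of these pairs form \<open>schur_kernel\<close>.\<close>

lemma arr_weight_insert:
  assumes "finite A" "i \<in> A" "\<And>j. j \<in> A - {i} \<Longrightarrow> a j < a i"
  shows "arr_weight x A a = x i ^ a i * schur_kernel x i (A - {i}) * arr_weight x (A - {i}) a"
proof -
  let ?E = "\<lambda>A. {(i, j). i \<in> A \<and> j \<in> A \<and> a j < a i}"
  let ?f = "\<lambda>(i, j). (x i + x j) / (x i - x j)"
  have fin: "finite (?E (A - {i}))"
    by (rule finite_subset[of _ "A \<times> A"]) (use assms in auto)
  have E: "(u, v) \<in> ?E A \<longleftrightarrow> (u, v) \<in> Pair i ` (A - {i}) \<union> ?E (A - {i})" for u v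
    using assms(2) assms(3)[of u] assms(3)[of v] by (cases "u = i"; cases "v = i") auto
  have "?E A = Pair i ` (A - {i}) \<union> ?E (A - {i})"
    by (rule set_eqI) (simp only: split_paired_all E)
  moreover have "prod ?f (Pair i ` (A - {i}) \<union> ?E (A - {i})) = prod ?f (Pair i ` (A - {i})) * prod ?f (?E (A - {i}))"
    using assms fin by (intro prod.union_disjoint) auto
  moreover have "prod ?f (Pair i ` (A - {i})) = schur_kernel x i (A - {i})"
    unfolding schur_kernel_def by (subst prod.reindex) (auto simp: inj_on_def)
  ultimately show ?thesis
    using assms by (simp add: arr_weight_def prod.remove[of A i] mult_ac)
qed

lemma arr_weight_cong: "(\<And>i. i \<in> A \<Longrightarrow> a i = b i) \<Longrightarrow> arr_weight x A a = arr_weight x A b"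
  unfolding arr_weight_def by (intro arg_cong2[where f = "(*)"] prod.cong) auto

text \<open>Since \<open>k\<close> exceeds all of \<open>M\<close>, exactly one variable carries the
  exponent \<open>k\<close>. Splitting by this variable gives the recursion of
  \<open>raise_op\<close>.\<close>

lemma sum_arrangements_add:
  assumes "finite A" "0 < k" "\<forall>j\<in>#M. j < k"
  shows "(\<Sum>a\<in>arrangements A (add_mset k M). arr_weight x A a) =
    (\<Sum>i\<in>A. x i ^ k * schur_kernel x i (A - {i}) * (\<Sum>a\<in>arrangements (A - {i}) M. arr_weight x (A - {i}) a))"
proof -
  let ?idx = "\<lambda>b. SOME i. i \<in> A \<and> b i = k"
  have notin: "k \<notin># M" using assms(3) by auto
  have upd: "a(i := k) \<in> arrangements A (add_mset k M)" "(a(i := k)) j < k \<longleftrightarrow> j \<noteq> i"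
    if "i \<in> A" "a \<in> arrangements (A - {i}) M" "j \<in> A" for i a j
  proof -
    have "image_mset (a(i := k)) (mset_set (A - {i})) = image_mset a (mset_set (A - {i}))"
      using assms by (intro image_mset_cong) auto
    then show "a(i := k) \<in> arrangements A (add_mset k M)"
      using that assms by (auto simp: arrangements_def filter_image_mset_remove[of A i] PiE_def extensional_def)
    show "(a(i := k)) j < k \<longleftrightarrow> j \<noteq> i"
      using arrangements_value[OF that(2), of j] that assms by auto
  qed
  have ex: "\<exists>i. i \<in> A \<and> b i = k" if "b \<in> arrangements A (add_mset k M)" for b
  proof -
    have "k \<in># filter_mset (\<lambda>k. 0 < k) (image_mset b (mset_set A))"
      using that by (simp add: arrangements_def)
    then show ?thesis
      using assms by auto
  qed
  have idx: "?idx b \<in> A" "b (?idx b) = k" if "b \<in> arrangements A (add_mset k M)" for b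
    using someI_ex[OF ex[OF that]] by auto
  have res: "restrict b (A - {i}) \<in> arrangements (A - {i}) M"
    if "b \<in> arrangements A (add_mset k M)" "i \<in> A" "b i = k" for b i
  proof -
    have "image_mset (restrict b (A - {i})) (mset_set (A - {i})) = image_mset b (mset_set (A - {i}))"
      using assms by (intro image_mset_cong) auto
    then show ?thesis
      using that assms by (auto simp: arrangements_def filter_image_mset_remove[of A i])
  qed
  have fin: "finite (arrangements (A - {i}) M)" for i
  proof (rule finite_subset)
    show "arrangements (A - {i}) M \<subseteq> (A - {i}) \<rightarrow>\<^sub>E {..k}"
    proof
      fix a assume a: "a \<in> arrangements (A - {i}) M"
      have "a j \<le> k" if "j \<in> A - {i}" for j
        using arrangements_value[OF a _ that] assms by (auto dest: bspec)
      then show "a \<in> (A - {i}) \<rightarrow>\<^sub>E {..k}"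
        using a by (auto simp: arrangements_def PiE_def)
    qed
  qed (use assms in \<open>auto intro: finite_PiE\<close>)
  have "(\<Sum>i\<in>A. x i ^ k * schur_kernel x i (A - {i}) * (\<Sum>a\<in>arrangements (A - {i}) M. arr_weight x (A - {i}) a)) =
     (\<Sum>(i, a)\<in>(SIGMA i:A. arrangements (A - {i}) M). x i ^ k * schur_kernel x i (A - {i}) * arr_weight x (A - {i}) a)"
    using assms fin by (simp add: sum.Sigma sum_distrib_left)
  also have "\<dots> = (\<Sum>a\<in>arrangements A (add_mset k M). arr_weight x A a)"
  proof (rule sum.reindex_bij_witness[of _ "\<lambda>b. (?idx b, restrict b (A - {?idx b}))" "\<lambda>(i, a). a(i := k)"])
    fix p assume p: "p \<in> (SIGMA i:A. arrangements (A - {i}) M)"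
    obtain i a where ia: "p = (i, a)" "i \<in> A" "a \<in> arrangements (A - {i}) M"
      using p by auto
    have arr: "a(i := k) \<in> arrangements A (add_mset k M)"
      by (rule upd(1)[OF ia(2,3,2)])
    have "?idx (a(i := k)) = i"
      using upd(2)[OF ia(2,3) idx(1)[OF arr]] idx(2)[OF arr] by (metis less_irrefl)
    moreover have "restrict (a(i := k)) (A - {i}) = a"
      using ia(3) by (auto simp: arrangements_def PiE_def extensional_def restrict_def fun_eq_iff)
    ultimately show "(?idx (case p of (i, a) \<Rightarrow> a(i := k)), restrict (case p of (i, a) \<Rightarrow> a(i := k)) (A - {?idx (case p of (i, a) \<Rightarrow> a(i := k))})) = p"
      by (simp add: ia)
    show "(case p of (i, a) \<Rightarrow> a(i := k)) \<in> arrangements A (add_mset k M)"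
      using arr ia by simp
    have "arr_weight x A (a(i := k)) =
        x i ^ k * schur_kernel x i (A - {i}) * arr_weight x (A - {i}) (a(i := k))"
    proof -
      have "(a(i := k)) j < (a(i := k)) i" if "j \<in> A - {i}" for j
        using upd(2)[OF ia(2,3), of j] that by auto
      from arr_weight_insert[where a = "a(i := k)" and x = x, OF assms(1) ia(2) this] show ?thesis
        by simp
    qed
    also have "arr_weight x (A - {i}) (a(i := k)) = arr_weight x (A - {i}) a"
      by (rule arr_weight_cong) auto
    finally show "arr_weight x A (case p of (i, a) \<Rightarrow> a(i := k)) =
      (case p of (i, a) \<Rightarrow> x i ^ k * schur_kernel x i (A - {i}) * arr_weight x (A - {i}) a)"
      unfolding ia(1) prod.case .
  next
    fix b assume b: "b \<in> arrangements A (add_mset k M)"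
    have "(restrict b (A - {?idx b}))(?idx b := k) = b"
      using idx[OF b] b by (auto simp: arrangements_def PiE_def extensional_def restrict_def fun_eq_iff)
    then show "(case (?idx b, restrict b (A - {?idx b})) of (i, a) \<Rightarrow> a(i := k)) = b"
      by simp
    show "(?idx b, restrict b (A - {?idx b})) \<in> (SIGMA i:A. arrangements (A - {i}) M)"
      using idx[OF b] res[OF b] by auto
  qed
  finally show ?thesis by simp
qed

lemma sum_arrangements_empty:
  assumes "finite A"
  shows "(\<Sum>a\<in>arrangements A {#}. arr_weight x A a) = 1"
proof -
  have "arrangements A {#} = {\<lambda>i\<in>A. 0}"
  proof (intro subset_antisym subsetI)
    fix a assume a: "a \<in> arrangements A {#}"
    then have "a i = 0" if "i \<in> A" for i
      using arrangements_value[OF a assms that] by simp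
    then show "a \<in> {\<lambda>i\<in>A. 0}"
      using a by (auto simp: arrangements_def PiE_def extensional_def)
  qed (auto simp: arrangements_def assms filter_mset_eq_conv)
  moreover have "arr_weight x A (\<lambda>i\<in>A. 0) = 1"
    by (simp add: arr_weight_def)
  ultimately show ?thesis
    by simp
qed

lemma sum_arrangements_strict:
  assumes "sorted_wrt (>) l" "0 \<notin> set l" "finite A"
  shows "(\<Sum>a\<in>arrangements A (mset l). arr_weight x A a) = foldr (raise_op x) l (\<lambda>_. 1) A"
  using assms
proof (induction l arbitrary: A)
  case Nil
  then show ?case
    by (simp add: sum_arrangements_empty)
next
  case (Cons k l)
  then show ?case
    by (simp add: sum_arrangements_add raise_op_def)
qed

lemma hall_littlewood_eq_arrangements:
  "hall_littlewood N l (-1) x = (\<Sum>a\<in>arrangements {..<N} (mset l). arr_weight x {..<N} a)"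
  unfolding hall_littlewood_def
proof (rule sum.reindex_bij_witness[of _ "\<lambda>a. map a [0..<N]" "\<lambda>a. \<lambda>i\<in>{..<N}. a ! i"])
  have set_upto: "mset_set {..<N} = mset [0..<N]"
    by (simp add: lessThan_atLeast0)
  {
    fix a assume a: "a \<in> {a. length a = N \<and> filter_mset (\<lambda>k. 0 < k) (mset a) = mset l}"
    then have len: "length a = N" by simp
    have "map (\<lambda>i\<in>{..<N}. a ! i) [0..<N] = map ((!) a) [0..<N]"
      by simp
    also have "\<dots> = a"
      using len map_nth by blast
    finally show map: "map (\<lambda>i\<in>{..<N}. a ! i) [0..<N] = a" .
    have "image_mset (\<lambda>i\<in>{..<N}. a ! i) (mset_set {..<N}) = mset a"
      unfolding set_upto by (metis map mset_map)
    then show "(\<lambda>i\<in>{..<N}. a ! i) \<in> arrangements {..<N} (mset l)"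
      using a by (simp add: arrangements_def)
    have "{(i, j). i < N \<and> j < N \<and> a ! j < a ! i} =
      {(i, j). i \<in> {..<N} \<and> j \<in> {..<N} \<and> (\<lambda>i\<in>{..<N}. a ! i) j < (\<lambda>i\<in>{..<N}. a ! i) i}"
      by auto
    then show "arr_weight x {..<N} (\<lambda>i\<in>{..<N}. a ! i) = (\<Prod>i<N. x i ^ (a ! i)) *
        (\<Prod>(i, j)\<in>{(i, j). i < N \<and> j < N \<and> a ! i > a ! j}. (x i - (-1) * x j) / (x i - x j))"
      unfolding arr_weight_def by (intro arg_cong2[where f = "(*)"] prod.cong) auto
  next
    fix b assume b: "b \<in> arrangements {..<N} (mset l)"
    then show "(\<lambda>i\<in>{..<N}. map b [0..<N] ! i) = b"
      by (auto simp: arrangements_def PiE_def extensional_def restrict_def fun_eq_iff)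
    show "map b [0..<N] \<in> {a. length a = N \<and> filter_mset (\<lambda>k. 0 < k) (mset a) = mset l}"
      using b by (simp add: arrangements_def set_upto)
  }
qed

section \<open>Strict partitions as finite sets of parts\<close>

lemma DP_strict: "l \<in> DP n \<Longrightarrow> sorted_wrt (>) l \<and> 0 \<notin> set l \<and> sum_list l = n"
proof -
  assume "l \<in> DP n"
  then have l: "sorted_wrt (\<ge>) l" "distinct l" "0 \<notin> set l" "sum_list l = n"
    by (auto simp: DP_def partitions_def)
  have "sorted_wrt (>) l"
    using l(1,2) by (induction l) (auto simp: order.strict_iff_order)
  then show ?thesis
    using l by simp
qed

lemma DP_I: "sorted_wrt (>) l \<Longrightarrow> 0 \<notin> set l \<Longrightarrow> sum_list l = n \<Longrightarrow> l \<in> DP n"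
proof -
  assume l: "sorted_wrt (>) l" "0 \<notin> set l" "sum_list l = n"
  have "sorted_wrt (\<ge>) l" "distinct l"
    using l(1) by (induction l) auto
  then show ?thesis
    using l by (simp add: DP_def partitions_def)
qed

lemma rev_sorted_list_of_set: "sorted_wrt (>) l \<Longrightarrow> rev (sorted_list_of_set (set l)) = (l :: nat list)"
proof -
  assume l: "sorted_wrt (>) l"
  have "sorted (rev l)" "distinct (rev l)"
    using l by (induction l) (auto simp: sorted_append less_imp_le)
  then show ?thesis
    using sorted_list_of_set.idem_if_sorted_distinct[of "rev l"] by simp
qed

lemma sum_list_strict: "sorted_wrt (>) l \<Longrightarrow> sum_list l = \<Sum>(set (l :: nat list))"
  by (induction l) auto

lemma card_strict: "sorted_wrt (>) l \<Longrightarrow> card (set (l :: nat list)) = length l"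
proof (rule distinct_card)
  show "sorted_wrt (>) l \<Longrightarrow> distinct l"
    by (induction l) auto
qed

lemma strict_list_of_fset:
  fixes S :: "nat fset"
  shows "sorted_wrt (>) (rev (sorted_list_of_set (fset S)))" "set (rev (sorted_list_of_set (fset S))) = fset S"
proof -
  have "sorted_wrt (<) (sorted_list_of_set (fset S))"
    by simp
  then show "sorted_wrt (>) (rev (sorted_list_of_set (fset S)))"
    by (simp only: sorted_wrt_rev)
qed simp

lemma bij_betw_DP_states: "bij_betw fset_of_list (DP n) (states (int n))"
proof (rule bij_betw_byWitness[where f' = "\<lambda>S. rev (sorted_list_of_set (fset S))"])
  show "\<forall>l\<in>DP n. rev (sorted_list_of_set (fset (fset_of_list l))) = l"
    by (auto simp: fset_of_list.rep_eq rev_sorted_list_of_set dest: DP_strict)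
  show "\<forall>S\<in>states (int n). fset_of_list (rev (sorted_list_of_set (fset S))) = S"
    by (auto simp: fset_of_list.rep_eq simp flip: fset_inject)
  show "fset_of_list ` DP n \<subseteq> states (int n)"
    by (auto simp: states_def weight_def fset_of_list.rep_eq sum_list_strict fset_of_list_elem dest!: DP_strict)
  show "(\<lambda>S. rev (sorted_list_of_set (fset S))) ` states (int n) \<subseteq> DP n"
  proof (intro image_subsetI DP_I)
    fix S assume S: "S \<in> states (int n)"
    have "weight S = n"
      using S unfolding states_def by (simp only: mem_Collect_eq of_nat_eq_iff)
    then show "sum_list (rev (sorted_list_of_set (fset S))) = n"
      unfolding weight_def sum_list_strict[OF strict_list_of_fset(1)] by simp
    show "0 \<notin> set (rev (sorted_list_of_set (fset S)))"
      using S by (simp add: states_def)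
  qed (rule strict_list_of_fset)
qed

lemma fcard_DP: "l \<in> DP n \<Longrightarrow> fcard (fset_of_list l) = length l"
  by (auto simp: fcard.rep_eq fset_of_list.rep_eq card_strict dest: DP_strict)

lemma hall_littlewood_DP:
  assumes "l \<in> DP n"
  shows "hall_littlewood N l (-1) x = Pfun x (fset_of_list l) {..<N}"
  using DP_strict[OF assms]
  by (simp add: hall_littlewood_eq_arrangements sum_arrangements_strict Pfun_def fset_of_list.rep_eq
      rev_sorted_list_of_set)

lemma length_partitions: "l \<in> partitions n \<Longrightarrow> length l \<le> n"
proof -
  have "length l \<le> sum_list l" if "0 \<notin> set l" for l :: "nat list"
    using that by (induction l) auto
  then show "l \<in> partitions n \<Longrightarrow> length l \<le> n"
    by (auto simp: partitions_def)
qed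

lemma finite_partitions [simp]: "finite (partitions n)"
proof (rule finite_subset)
  show "partitions n \<subseteq> {l. set l \<subseteq> {..n} \<and> length l \<le> n}"
    using length_partitions by (auto simp: partitions_def member_le_sum_list)
qed (simp add: finite_lists_length_le)

lemma finite_DP [simp]: "finite (DP n)" and finite_OP [simp]: "finite (OP n)"
  by (auto simp: DP_def OP_def)

section \<open>Expansion of power sums with odd parts\<close>

text \<open>Only strict partitions receive a coefficient, although the expansion ranges over all
  partitions; \<open>is_HL_expansion_unique\<close> identifies these numbers with
  \<open>X_coeff\<close>.\<close>

definition HL_coeff :: "nat list \<Rightarrow> nat list \<Rightarrow> real" where
  "HL_coeff m l = (if l \<in> DP (sum_list m) then fock_vec m (fset_of_list l) else 0)"

lemma is_HL_expansion_HL_coeff: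
  assumes "\<forall>j\<in>set m. odd j"
  shows "is_HL_expansion m (HL_coeff m)"
  unfolding is_HL_expansion_def
proof (intro conjI allI impI)
  fix l assume "l \<notin> partitions (sum_list m)"
  then show "HL_coeff m l = 0"
    by (auto simp: HL_coeff_def DP_def)
next
  fix N and x :: "nat \<Rightarrow> real" assume x: "inj_on x {..<N}"
  let ?n = "sum_list m"
  have "(\<Sum>l\<in>partitions ?n. HL_coeff m l * hall_littlewood N l (-1) x) =
      (\<Sum>l\<in>DP ?n. fock_vec m (fset_of_list l) * Pfun x (fset_of_list l) {..<N})"
    by (intro sum.mono_neutral_cong_right) (auto simp: HL_coeff_def hall_littlewood_DP DP_def)
  also have "\<dots> = eval_state x (int ?n) (fock_vec m) {..<N}"
    unfolding eval_state_def by (rule sum.reindex_bij_betw[OF bij_betw_DP_states])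
  also have "\<dots> = (\<Prod>k\<leftarrow>m. psum x k {..<N})"
    using assms x by (intro eval_state_fock_vec) auto
  finally show "power_sum N m x = (\<Sum>l\<in>partitions ?n. HL_coeff m l * hall_littlewood N l (-1) x)"
    by (simp add: power_sum_def psum_def)
qed

section \<open>Uniqueness of Hall-Littlewood expansions\<close>

lemma tendsto_power_quotient:
  assumes "p \<noteq> q"
  shows "((\<lambda>t :: real. (t ^ p + t ^ q) / (t ^ p - t ^ q)) \<longlongrightarrow> (if q < p then 1 else - 1)) at_top"
proof -
  have lim: "((\<lambda>t :: real. (t ^ p + t ^ q) / (t ^ p - t ^ q)) \<longlongrightarrow> 1) at_top" if "q < p" for p q :: nat
  proof -
    have "((\<lambda>t :: real. (1 + inverse t ^ (p - q)) / (1 - inverse t ^ (p - q))) \<longlongrightarrow>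
        (1 + 0 ^ (p - q)) / (1 - 0 ^ (p - q))) at_top"
      using that by (intro tendsto_intros tendsto_inverse_0_at_top filterlim_ident) (simp add: power_0_left)
    moreover have "eventually (\<lambda>t :: real. (1 + inverse t ^ (p - q)) / (1 - inverse t ^ (p - q)) =
        (t ^ p + t ^ q) / (t ^ p - t ^ q)) at_top"
      using eventually_gt_at_top[of 0]
    proof eventually_elim
      case (elim t)
      have "t ^ q = t ^ p * inverse t ^ (p - q)"
        using that elim by (simp add: power_diff field_simps)
      then have "(t ^ p + t ^ q) / (t ^ p - t ^ q) =
          (t ^ p * (1 + inverse t ^ (p - q))) / (t ^ p * (1 - inverse t ^ (p - q)))"
        by (simp add: algebra_simps)
      also have "\<dots> = (1 + inverse t ^ (p - q)) / (1 - inverse t ^ (p - q))"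
        using elim by simp
      finally show ?case ..
    qed
    ultimately show ?thesis
      using that by (simp add: tendsto_cong power_0_left)
  qed
  show ?thesis
  proof (cases "q < p")
    case False
    then have "((\<lambda>t :: real. - ((t ^ q + t ^ p) / (t ^ q - t ^ p))) \<longlongrightarrow> - 1) at_top"
      using assms by (intro tendsto_minus lim) simp
    moreover have "- ((t ^ q + t ^ p) / (t ^ q - t ^ p)) = (t ^ p + t ^ q) / (t ^ p - t ^ q)" for t :: real
      by (metis add.commute minus_diff_eq minus_divide_right)
    ultimately show ?thesis
      using False by simp
  qed (use lim in simp)
qed

lemma tendsto_power_ratio:
  assumes "p < q"
  shows "((\<lambda>t :: real. t ^ p / t ^ q) \<longlongrightarrow> 0) at_top"
proof -
  have "((\<lambda>t :: real. inverse t ^ (q - p)) \<longlongrightarrow> 0 ^ (q - p)) at_top"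
    by (intro tendsto_intros tendsto_inverse_0_at_top filterlim_ident)
  moreover have "eventually (\<lambda>t :: real. inverse t ^ (q - p) = t ^ p / t ^ q) at_top"
    using eventually_gt_at_top[of 0]
    by eventually_elim (use assms in \<open>simp add: power_diff field_simps\<close>)
  ultimately show ?thesis
    using assms by (simp add: tendsto_cong power_0_left)
qed

lemma radix_inj:
  fixes a b :: "nat \<Rightarrow> nat"
  assumes "(\<Sum>i<N. a i * B ^ i) = (\<Sum>i<N. b i * B ^ i)" "\<And>i. i < N \<Longrightarrow> a i < B \<and> b i < B" "i < N"
  shows "a i = b i"
  using assms
proof (induction N arbitrary: a b i)
  case (Suc N)
  have shift: "(\<Sum>i<Suc N. f i * B ^ i) = f 0 + B * (\<Sum>i<N. f (Suc i) * B ^ i)" for f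
    by (simp add: sum.lessThan_Suc_shift sum_distrib_left mult_ac del: sum.lessThan_Suc)
  have eq: "a 0 + B * (\<Sum>i<N. a (Suc i) * B ^ i) = b 0 + B * (\<Sum>i<N. b (Suc i) * B ^ i)"
    using Suc.prems(1) unfolding shift .
  have less: "a 0 < B" "b 0 < B"
    using Suc.prems(2)[of 0] by auto
  from arg_cong[OF eq, of "\<lambda>z. z mod B"] have "a 0 = b 0"
    using less by simp
  moreover from this have "(\<Sum>i<N. a (Suc i) * B ^ i) = (\<Sum>i<N. b (Suc i) * B ^ i)"
    using eq less by simp
  then have "a (Suc i) = b (Suc i)" if "i < N" for i
    using Suc.IH[of "\<lambda>i. a (Suc i)" "\<lambda>i. b (Suc i)" i] Suc.prems(2) that by simp
  ultimately show ?case
    using Suc.prems(3) by (cases i) auto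
qed simp

definition pos_part :: "nat list \<Rightarrow> nat list" where
  "pos_part a = rev (sort (filter (\<lambda>k. 0 < k) a))"

definition words :: "nat \<Rightarrow> nat \<Rightarrow> nat list set" where
  "words N n = {a. length a = N \<and> sum_list a = n}"

lemma finite_words [simp]: "finite (words N n)"
proof (rule finite_subset)
  show "words N n \<subseteq> {a. set a \<subseteq> {..n} \<and> length a = N}"
    by (auto simp: words_def member_le_sum_list)
qed (simp add: finite_lists_length_eq)

lemma sum_list_filter_pos: "sum_list (filter (\<lambda>k. 0 < k) a) = sum_list (a :: nat list)"
  by (induction a) auto

lemma sum_list_mset_cong: "mset a = mset b \<Longrightarrow> sum_list a = sum_list (b :: nat list)"
  by (metis sum_mset_sum_list)

lemma mset_pos_part: "mset (pos_part a) = filter_mset (\<lambda>k. 0 < k) (mset a)"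
  by (simp add: pos_part_def)

lemma pos_part_partitions:
  assumes "a \<in> words N n"
  shows "pos_part a \<in> partitions n"
proof -
  have "sum_list (pos_part a) = sum_list (filter (\<lambda>k. 0 < k) a)"
    by (rule sum_list_mset_cong) (simp add: pos_part_def)
  moreover have "sorted_wrt (\<ge>) (pos_part a)"
    by (simp add: pos_part_def sorted_wrt_rev)
  ultimately show ?thesis
    using assms by (simp add: partitions_def words_def sum_list_filter_pos) (simp add: pos_part_def)
qed

lemma partitions_mset_eqD:
  assumes "l \<in> partitions n" "l' \<in> partitions n" "mset l = mset l'"
  shows "l = l'"
proof -
  have "sorted (rev l)" "sorted (rev l')"
    using assms by (simp_all add: partitions_def sorted_wrt_rev)
  then have "rev l = rev l'"
    using assms(3) by (metis mset_rev properties_for_sort)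
  then show ?thesis by simp
qed

lemma fibre_pos_part:
  assumes "l \<in> partitions n"
  shows "{a \<in> words N n. pos_part a = l} = {a. length a = N \<and> filter_mset (\<lambda>k. 0 < k) (mset a) = mset l}"
proof -
  have "pos_part a = l \<and> sum_list a = n \<longleftrightarrow> filter_mset (\<lambda>k. 0 < k) (mset a) = mset l" if "length a = N" for a
  proof
    assume "pos_part a = l \<and> sum_list a = n"
    then show "filter_mset (\<lambda>k. 0 < k) (mset a) = mset l"
      using mset_pos_part[of a] by simp
  next
    assume *: "filter_mset (\<lambda>k. 0 < k) (mset a) = mset l"
    have "sum_list a = sum_list l"
      using sum_list_mset_cong[of "filter (\<lambda>k. 0 < k) a" l] * by (simp add: sum_list_filter_pos)
    then have "sum_list a = n"
      using assms by (simp add: partitions_def)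
    moreover from this have "pos_part a = l"
      using pos_part_partitions[of a N n] that assms * mset_pos_part[of a]
      by (intro partitions_mset_eqD) (auto simp: words_def)
    ultimately show "pos_part a = l \<and> sum_list a = n" by simp
  qed
  then show ?thesis
    by (auto simp: words_def)
qed

definition word_factor :: "(nat \<Rightarrow> real) \<Rightarrow> nat \<Rightarrow> nat list \<Rightarrow> real" where
  "word_factor x N a = (\<Prod>(i, j)\<in>{(i, j). i < N \<and> j < N \<and> a ! j < a ! i}. (x i + x j) / (x i - x j))"

text \<open>The words that define \<open>hall_littlewood\<close> for one partition form a fibre of
  \<open>pos_part\<close>, so the double sum merges into a single sum over words.\<close>

lemma sum_hall_littlewood:
  "(\<Sum>l\<in>partitions n. c l * hall_littlewood N l (-1) x) =
     (\<Sum>a\<in>words N n. c (pos_part a) * ((\<Prod>i<N. x i ^ (a ! i)) * word_factor x N a))"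
proof -
  have "(\<Sum>l\<in>partitions n. c l * hall_littlewood N l (-1) x) =
     (\<Sum>l\<in>partitions n. \<Sum>a\<in>{a \<in> words N n. pos_part a = l}. c (pos_part a) * ((\<Prod>i<N. x i ^ (a ! i)) * word_factor x N a))"
  proof (intro sum.cong refl)
    fix l assume l: "l \<in> partitions n"
    have "c l * hall_littlewood N l (-1) x =
        (\<Sum>a\<in>{a \<in> words N n. pos_part a = l}. c l * ((\<Prod>i<N. x i ^ (a ! i)) * word_factor x N a))"
      unfolding fibre_pos_part[OF l] hall_littlewood_def word_factor_def sum_distrib_left by simp
    also have "\<dots> = (\<Sum>a\<in>{a \<in> words N n. pos_part a = l}. c (pos_part a) * ((\<Prod>i<N. x i ^ (a ! i)) * word_factor x N a))"
      by (intro sum.cong) auto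
    finally show "c l * hall_littlewood N l (-1) x = \<dots>" .
  qed
  also have "\<dots> = (\<Sum>a\<in>words N n. c (pos_part a) * ((\<Prod>i<N. x i ^ (a ! i)) * word_factor x N a))"
    by (rule sum.group) (auto intro: pos_part_partitions)
  finally show ?thesis .
qed

text \<open>At \<open>x\<^sub>i = t ^ (B ^ i)\<close>, each word contributes the power of \<open>t\<close> whose exponent has the word as its
  base \<open>B\<close> expansion, times a factor that tends to \<open>1\<close> or \<open>-1\<close> as \<open>t\<close> grows; so the word with the
  largest exponent cannot be cancelled.\<close>

lemma hall_littlewood_independent:
  fixes c :: "nat list \<Rightarrow> real"
  assumes "\<And>x. inj_on x {..<N} \<Longrightarrow> (\<Sum>l\<in>partitions n. c l * hall_littlewood N l (-1) x) = 0"
    and "a \<in> words N n"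
  shows "c (pos_part a) = 0"
proof (rule ccontr)
  assume nz: "c (pos_part a) \<noteq> 0"
  \<comment> \<open>Larger than every entry of a word, so that exponents determine words, and larger
    than \<open>1\<close> even for \<open>n = 0\<close>, so that the points are distinct.\<close>
  define B where "B = n + 2"
  define code where "code a = (\<Sum>i<N. a ! i * B ^ i)" for a :: "nat list"
  define x where "x t i = t ^ (B ^ i)" for t :: real and i
  define L where "L a = (\<Prod>(i, j)\<in>{(i, j). i < N \<and> j < N \<and> a ! j < a ! i}. if j < i then 1 else - 1 :: real)"
    for a :: "nat list"
  have B: "1 < B" by (simp add: B_def)
  have code_inj: "a = b" if "a \<in> words N n" "b \<in> words N n" "code a = code b" for a b
  proof (rule nth_equalityI)
    have "c ! i < B" if "c \<in> words N n" "i < N" for c i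
      using that member_le_sum_list[of "c ! i" c] by (simp add: words_def B_def)
    then show "a ! i = b ! i" if "i < length a" for i
      using \<open>a \<in> words N n\<close> \<open>b \<in> words N n\<close> \<open>code a = code b\<close> that
        radix_inj[of "(!) a" B N "(!) b" i] by (simp add: code_def words_def)
  qed (use that in \<open>simp add: words_def\<close>)
  have mono: "(\<Prod>i<N. x t i ^ (a ! i)) = t ^ code a" for t a
    by (simp add: x_def code_def power_sum mult.commute flip: power_mult)
  have factor: "((\<lambda>t. word_factor (x t) N a) \<longlongrightarrow> L a) at_top" for a
    unfolding word_factor_def L_def case_prod_unfold
  proof (rule tendsto_prod)
    fix p assume p: "p \<in> {p. fst p < N \<and> snd p < N \<and> a ! snd p < a ! fst p}"
    have "B ^ fst p \<noteq> B ^ snd p" "B ^ snd p < B ^ fst p \<longleftrightarrow> snd p < fst p"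
      using B p by (auto simp: power_inject_exp power_strict_increasing_iff)
    then show "((\<lambda>t. (x t (fst p) + x t (snd p)) / (x t (fst p) - x t (snd p))) \<longlongrightarrow>
        (if snd p < fst p then 1 else - 1)) at_top"
      using tendsto_power_quotient[of "B ^ fst p" "B ^ snd p"] by (simp add: x_def)
  qed
  have L_nz: "L a \<noteq> 0" for a
  proof -
    have "finite {(i, j). i < N \<and> j < N \<and> a ! j < a ! i}"
      by (rule finite_subset[of _ "{..<N} \<times> {..<N}"]) auto
    then show ?thesis
      by (auto simp: L_def)
  qed
  define Z where "Z = {a \<in> words N n. c (pos_part a) \<noteq> 0}"
  have Z: "finite Z" "Z \<noteq> {}"
    using assms(2) nz by (auto simp: Z_def)
  obtain b where b: "b \<in> Z" "\<And>a. a \<in> Z \<Longrightarrow> code a \<le> code b"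
  proof -
    have "Max (code ` Z) \<in> code ` Z"
      using Z by (intro Max_in) auto
    then obtain b where b: "b \<in> Z" "Max (code ` Z) = code b"
      by auto
    have "code a \<le> Max (code ` Z)" if "a \<in> Z" for a
      using Z that by (intro Max_ge) auto
    then show ?thesis
      using that b by metis
  qed
  have zero: "(\<Sum>a\<in>words N n. c (pos_part a) * (t ^ code a / t ^ code b * word_factor (x t) N a)) = 0"
    if "1 < t" for t
  proof -
    have "inj_on (x t) {..<N}"
      using that B by (auto simp: inj_on_def x_def power_inject_exp)
    then have "(\<Sum>a\<in>words N n. c (pos_part a) * (t ^ code a * word_factor (x t) N a)) / t ^ code b = 0"
      using assms(1)[of "x t"] unfolding sum_hall_littlewood mono by simp
    then show ?thesis
      unfolding sum_divide_distrib by simp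
  qed
  have "((\<lambda>t. \<Sum>a\<in>words N n. c (pos_part a) * (t ^ code a / t ^ code b * word_factor (x t) N a)) \<longlongrightarrow>
      (\<Sum>a\<in>words N n. if a = b then c (pos_part b) * L b else 0)) at_top"
  proof (rule tendsto_sum)
    fix a assume a: "a \<in> words N n"
    \<comment> \<open>Distinct words have distinct exponents, and \<open>b\<close> has the largest
      one among the words with nonzero coefficient.\<close>
    consider "a = b" | "a \<noteq> b" "c (pos_part a) = 0" | "a \<noteq> b" "code a < code b"
      using a b code_inj[OF a, of b] by (force simp: Z_def less_le)
    then show "((\<lambda>t. c (pos_part a) * (t ^ code a / t ^ code b * word_factor (x t) N a)) \<longlongrightarrow>
        (if a = b then c (pos_part b) * L b else 0)) at_top"
    proof cases
      case 1
      have "((\<lambda>t. c (pos_part b) * (1 * word_factor (x t) N b)) \<longlongrightarrow> c (pos_part b) * (1 * L b)) at_top"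
        by (intro tendsto_intros factor)
      moreover have "eventually (\<lambda>t :: real. c (pos_part b) * (1 * word_factor (x t) N b) =
          c (pos_part b) * (t ^ code b / t ^ code b * word_factor (x t) N b)) at_top"
        using eventually_gt_at_top[of 0] by eventually_elim simp
      ultimately have "((\<lambda>t. c (pos_part b) * (t ^ code b / t ^ code b * word_factor (x t) N b)) \<longlongrightarrow>
          c (pos_part b) * (1 * L b)) at_top"
        by (rule Lim_transform_eventually)
      then show ?thesis
        using 1 by simp
    next
      case 3
      then have "((\<lambda>t. c (pos_part a) * (t ^ code a / t ^ code b * word_factor (x t) N a)) \<longlongrightarrow>
          c (pos_part a) * (0 * L a)) at_top"
        by (intro tendsto_intros factor tendsto_power_ratio)
      then show ?thesis
        using 3 by simp
    qed simp
  qed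
  moreover have "((\<lambda>t. \<Sum>a\<in>words N n. c (pos_part a) * (t ^ code a / t ^ code b * word_factor (x t) N a)) \<longlongrightarrow> 0) at_top"
    by (rule tendsto_eventually, rule eventually_mono[OF eventually_gt_at_top[of 1]], rule zero)
  ultimately have "(\<Sum>a\<in>words N n. if a = b then c (pos_part b) * L b else 0) = 0"
    using tendsto_unique trivial_limit_at_top_linorder by blast
  then show False
    using b(1) L_nz[of b] by (simp add: Z_def)
qed

text \<open>With as many variables as the size, every partition of that size can be padded with
  zeros to a word, so \<open>hall_littlewood_independent\<close> reaches its coefficient.\<close>

lemma is_HL_expansion_unique:
  assumes "is_HL_expansion m c" "is_HL_expansion m c'"
  shows "c = c'"
proof
  fix l
  let ?n = "sum_list m"
  show "c l = c' l"
  proof (cases "l \<in> partitions ?n")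
    case True
    define a where "a = l @ replicate (?n - length l) 0"
    have a: "a \<in> words ?n ?n"
      using length_partitions[OF True] True by (simp add: a_def words_def partitions_def sum_list_replicate)
    have "filter (\<lambda>k. 0 < k) a = l"
      using True by (auto simp: a_def partitions_def filter_id_conv intro!: gr0I)
    then have "filter_mset (\<lambda>k. 0 < k) (mset a) = mset l"
      by (simp only: mset_filter[symmetric])
    then have "a \<in> {a \<in> words ?n ?n. pos_part a = l}"
      unfolding fibre_pos_part[OF True] using a by (simp add: words_def)
    then have "pos_part a = l"
      by simp
    moreover have "c (pos_part a) - c' (pos_part a) = 0"
    proof (rule hall_littlewood_independent[where c = "\<lambda>l. c l - c' l"])
      fix x :: "nat \<Rightarrow> real" assume "inj_on x {..<?n}"
      then show "(\<Sum>l\<in>partitions ?n. (c l - c' l) * hall_littlewood ?n l (-1) x) = 0"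
        using assms unfolding is_HL_expansion_def by (simp add: left_diff_distrib sum_subtractf)
    qed (rule a)
    ultimately show ?thesis by simp
  next
    case False
    then show ?thesis
      using assms by (simp add: is_HL_expansion_def)
  qed
qed

lemma X_coeff_eq:
  assumes "\<forall>j\<in>set m. odd j"
  shows "X_coeff l m = HL_coeff m l"
proof -
  have "(THE c. is_HL_expansion m c) = HL_coeff m"
    using is_HL_expansion_HL_coeff[OF assms] by (blast intro: the_equality is_HL_expansion_unique)
  then show ?thesis
    by (simp add: X_coeff_def)
qed

section \<open>Shifted diagrams and partition counts\<close>

text \<open>Padding with zeros makes a new row the same kind of change as a longer row: one value
  grows by one.\<close>

definition part :: "nat list \<Rightarrow> nat \<Rightarrow> nat" where
  "part l i = (if i < length l then l ! i else 0)"

lemma mem_shifted_diagram: "(i, j) \<in> shifted_diagram l \<longleftrightarrow> i \<le> j \<and> j < i + part l i"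
  by (auto simp: shifted_diagram_def part_def)

text \<open>Rows are intervals with fixed left ends, so comparing cardinalities shows that the extra
  box lengthens exactly one row.\<close>

lemma insert_shifted_diagram_iff:
  "(\<exists>b. b \<notin> shifted_diagram t \<and> shifted_diagram l = insert b (shifted_diagram t)) \<longleftrightarrow>
     (\<exists>p. part l = (part t)(p := Suc (part t p)))"
proof
  assume "\<exists>b. b \<notin> shifted_diagram t \<and> shifted_diagram l = insert b (shifted_diagram t)"
  then obtain p q where b: "(p, q) \<notin> shifted_diagram t" "shifted_diagram l = insert (p, q) (shifted_diagram t)"
    by auto
  have row: "{j. (i, j) \<in> shifted_diagram l} = {i..<i + part l i}" for l i
    by (auto simp: mem_shifted_diagram)
  have "part l i = ((part t)(p := Suc (part t p))) i" for i
  proof (cases "i = p")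
    case True
    have "{p..<p + part l p} = insert q {p..<p + part t p}" "q \<notin> {p..<p + part t p}"
      using b unfolding row[symmetric] by auto
    then have "card {p..<p + part l p} = Suc (card {p..<p + part t p})"
      by simp
    then show ?thesis
      using True by simp
  next
    case False
    have "{i..<i + part l i} = {i..<i + part t i}"
      using b False unfolding row[symmetric] by auto
    then have "card {i..<i + part l i} = card {i..<i + part t i}"
      by simp
    then show ?thesis
      using False by simp
  qed
  then show "\<exists>p. part l = (part t)(p := Suc (part t p))"
    by blast
next
  assume "\<exists>p. part l = (part t)(p := Suc (part t p))"
  then obtain p where p: "part l = (part t)(p := Suc (part t p))" by blast
  have "shifted_diagram l = insert (p, p + part t p) (shifted_diagram t)"
  proof (rule set_eqI)
    show "z \<in> shifted_diagram l \<longleftrightarrow> z \<in> insert (p, p + part t p) (shifted_diagram t)" for z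
      by (cases z) (auto simp: mem_shifted_diagram p)
  qed
  moreover have "(p, p + part t p) \<notin> shifted_diagram t"
    by (simp add: mem_shifted_diagram)
  ultimately show "\<exists>b. b \<notin> shifted_diagram t \<and> shifted_diagram l = insert b (shifted_diagram t)"
    by blast
qed

lemma mem_set_part: "0 \<notin> set l \<Longrightarrow> v \<in> set l \<longleftrightarrow> v \<noteq> 0 \<and> (\<exists>i. part l i = v)"
  by (auto simp: part_def in_set_conv_nth split: if_splits)

lemma part_inj:
  assumes "sorted_wrt (>) l" "part l i = part l j" "part l i \<noteq> 0"
  shows "i = j"
proof (rule linorder_cases[of i j])
  assume "i < j"
  then show ?thesis
    using assms sorted_wrt_nth_less[OF assms(1), of i j] by (auto simp: part_def split: if_splits)
next
  assume "j < i"
  then show ?thesis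
    using assms sorted_wrt_nth_less[OF assms(1), of j i] by (auto simp: part_def split: if_splits)
qed

text \<open>If \<open>Suc k\<close> were already a part of \<open>t\<close>, it would occur twice in
  \<open>l\<close>. Distinctness of the parts of \<open>t\<close> also makes a positive
  \<open>k\<close> disappear when its row grows.\<close>

lemma raise_part_set:
  assumes t: "sorted_wrt (>) t" "0 \<notin> set t" and l: "sorted_wrt (>) l" "0 \<notin> set l"
    and p: "part l = (part t)(p := Suc (part t p))"
  defines "k \<equiv> part t p"
  shows "(k = 0 \<or> k \<in> set t) \<and> Suc k \<notin> set t \<and> set l = insert (Suc k) (set t - {k})"
proof (intro conjI)
  show "k = 0 \<or> k \<in> set t"
    using t(2) by (auto simp: mem_set_part k_def)
  show "Suc k \<notin> set t"
  proof
    assume "Suc k \<in> set t"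
    then obtain i where i: "part t i = Suc k"
      using t(2) by (auto simp: mem_set_part)
    then have "i \<noteq> p" by (auto simp: k_def)
    then have "part l i = part l p" "part l i \<noteq> 0"
      using i by (simp_all add: p k_def)
    then show False
      using part_inj[OF l(1)] \<open>i \<noteq> p\<close> by blast
  qed
  show "set l = insert (Suc k) (set t - {k})"
  proof (rule set_eqI)
    fix v
    have "(\<exists>i. i \<noteq> p \<and> part t i = v) \<longleftrightarrow> (\<exists>i. part t i = v) \<and> v \<noteq> k" if "v \<noteq> 0"
      using part_inj[OF t(1)] that unfolding k_def by metis
    moreover have "(\<exists>i. part l i = v) \<longleftrightarrow> v = Suc k \<or> (\<exists>i. i \<noteq> p \<and> part t i = v)"
      by (auto simp: p k_def)
    ultimately show "v \<in> set l \<longleftrightarrow> v \<in> insert (Suc k) (set t - {k})"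
      using t(2) l(2) by (auto simp: mem_set_part)
  qed
qed

lemma strict_eqI: "sorted_wrt (>) l \<Longrightarrow> sorted_wrt (>) l' \<Longrightarrow> set l = set (l' :: nat list) \<Longrightarrow> l = l'"
  using rev_sorted_list_of_set by metis

text \<open>As \<open>Suc k\<close> is not yet a part, replacing \<open>k\<close> by it in place
  keeps the list decreasing and no reordering occurs; for \<open>k = 0\<close> a part
  \<open>1\<close> is appended.\<close>

lemma raise_set_part:
  assumes t: "sorted_wrt (>) t" "0 \<notin> set t" and l: "sorted_wrt (>) l" "0 \<notin> set l"
    and k: "k = 0 \<or> k \<in> set t" "Suc k \<notin> set t" "set l = insert (Suc k) (set t - {k})"
  shows "\<exists>p. part l = (part t)(p := Suc (part t p))"
proof (cases "k = 0")
  case True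
  have gt: "1 < x" if "x \<in> set t" for x
    using that k(2) True t(2) by (metis One_nat_def Suc_lessI gr0I)
  have "l = t @ [1]"
  proof (rule strict_eqI[OF l(1)])
    show "sorted_wrt (>) (t @ [1])"
      using t gt by (simp add: sorted_wrt_append)
    show "set l = set (t @ [1])"
      using k True t by auto
  qed
  then have "part l = (part t)(length t := Suc (part t (length t)))"
    by (auto simp: part_def nth_append fun_eq_iff)
  then show ?thesis ..
next
  case False
  then obtain xs ys where xs: "t = xs @ k # ys"
    using k(1) split_list by metis
  have gt: "Suc k < x" if "x \<in> set xs" for x
  proof -
    have "k < x" "x \<noteq> Suc k"
      using that xs t(1) k(2) by (auto simp: sorted_wrt_append)
    then show ?thesis by simp
  qed
  have "l = xs @ Suc k # ys"
  proof (rule strict_eqI[OF l(1)])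
    show "sorted_wrt (>) (xs @ Suc k # ys)"
      using t(1) xs gt by (auto simp: sorted_wrt_append less_SucI)
    have "k \<notin> set xs" "k \<notin> set ys"
      using t(1) xs by (auto simp: sorted_wrt_append)
    then show "set l = set (xs @ Suc k # ys)"
      using k(3) xs by auto
  qed
  then have "part l = (part t)(length xs := Suc (part t (length xs)))"
    unfolding xs by (auto simp: part_def nth_append fun_eq_iff nth_Cons')
  then show ?thesis ..
qed

lemma covers_iff_raises:
  assumes "t \<in> DP m" "l \<in> DP n"
  shows "t \<nearrow> l \<longleftrightarrow> raises (fset_of_list t) (fset_of_list l)"
proof -
  have t: "sorted_wrt (>) t" "0 \<notin> set t" and l: "sorted_wrt (>) l" "0 \<notin> set l"
    using assms DP_strict by blast+
  have "fset_of_list l = finsert (Suc k) (fset_of_list t |-| {|k|}) \<longleftrightarrow> set l = insert (Suc k) (set t - {k})" for k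
    by (simp add: fset_of_list.rep_eq flip: fset_inject)
  then have "raises (fset_of_list t) (fset_of_list l) \<longleftrightarrow>
      (\<exists>k. (k = 0 \<or> k \<in> set t) \<and> Suc k \<notin> set t \<and> set l = insert (Suc k) (set t - {k}))"
    by (simp add: raises_def fset_of_list_elem)
  also have "\<dots> \<longleftrightarrow> (\<exists>p. part l = (part t)(p := Suc (part t p)))"
    using raise_part_set[OF t l] raise_set_part[OF t l] by metis
  also have "\<dots> \<longleftrightarrow> t \<nearrow> l"
    using assms unfolding covers_def insert_shifted_diagram_iff by blast
  finally show ?thesis ..
qed

text \<open>Numbering the boxes row by row gives a standard tableau. Positivity is what permits
  cancelling \<open>g_num\<close> against the denominators of the walk and of
  \<open>psi\<close>.\<close>

lemma g_num_pos: "0 < g_num l"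
proof -
  let ?D = "shifted_diagram l"
  \<comment> \<open>The number of boxes in the rows above row \<open>i\<close>.\<close>
  define s where "s i = sum_list (take i l)" for i
  define T where "T = (\<lambda>(i, j)\<in>?D. Suc (s i + (j - i)))"
  have s_Suc: "s (Suc i) = s i + l ! i" if "i < length l" for i
    using that by (simp add: s_def take_Suc_conv_app_nth)
  have s_mono: "s i \<le> s j" if "i \<le> j" for i j
  proof -
    have "take j l = take i l @ take (j - i) (drop i l)"
      using that by (metis le_add_diff_inverse take_add)
    then show ?thesis
      by (simp add: s_def)
  qed
  have T: "T (i, j) = Suc (s i + (j - i))" if "(i, j) \<in> ?D" for i j
    using that by (simp add: T_def)
  have bounds: "s i < T (i, j)" "T (i, j) \<le> s (Suc i)" if "(i, j) \<in> ?D" for i j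
    using that s_Suc[of i] unfolding T[OF that] by (auto simp: shifted_diagram_def)
  have row_less: "T (i, j) < T (i', j')" if "(i, j) \<in> ?D" "(i', j') \<in> ?D" "i < i'" for i i' j j'
    using bounds(2)[OF that(1)] bounds(1)[OF that(2)] s_mono[of "Suc i" i'] that(3) by linarith
  have D: "?D = (SIGMA i:{..<length l}. {i..<i + l ! i})"
    by (auto simp: shifted_diagram_def)
  have card: "card ?D = sum_list l"
    unfolding D by (simp add: card_SigmaI sum_list_sum_nth lessThan_atLeast0)
  have fin: "finite ?D"
    unfolding D by auto
  have inj: "inj_on T ?D"
  proof (rule inj_onI)
    fix z w assume zw: "z \<in> ?D" "w \<in> ?D" "T z = T w"
    obtain i j i' j' where [simp]: "z = (i, j)" "w = (i', j')"
      by (metis surj_pair)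
    have "i = i'"
      using row_less[of i j i' j'] row_less[of i' j' i j] zw by (metis \<open>w = (i', j')\<close> \<open>z = (i, j)\<close> less_irrefl linorder_neqE_nat)
    then show "z = w"
      using zw T by (auto simp: shifted_diagram_def)
  qed
  have "T ` ?D \<subseteq> {1..sum_list l}"
  proof (intro image_subsetI)
    fix z assume z: "z \<in> ?D"
    obtain i j where ij: "z = (i, j)" by (metis surj_pair)
    have "s (Suc i) \<le> s (length l)"
      using z ij by (intro s_mono) (auto simp: shifted_diagram_def)
    then show "T z \<in> {1..sum_list l}"
      using bounds[of i j] z ij by (simp add: s_def)
  qed
  then have "T ` ?D = {1..sum_list l}"
    using card_image[OF inj] card by (intro card_subset_eq) auto
  then have bij: "bij_betw T ?D {1..sum_list l}"
    using inj by (simp add: bij_betw_def)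
  have "T \<in> standard_shifted_tableaux l"
    unfolding standard_shifted_tableaux_def
  proof (intro CollectI conjI allI impI)
    show "T \<in> extensional ?D"
      by (simp add: T_def extensional_def)
    fix i j j' assume "(i, j) \<in> ?D" "(i, j') \<in> ?D" "j < j'"
    then show "T (i, j) < T (i, j')"
      by (simp add: T mem_shifted_diagram)
  qed (use bij row_less in auto)
  moreover have "finite (standard_shifted_tableaux l)"
  proof (rule finite_subset)
    show "standard_shifted_tableaux l \<subseteq> ?D \<rightarrow>\<^sub>E {1..sum_list l}"
      by (auto simp: standard_shifted_tableaux_def PiE_def dest: bij_betwE)
  qed (use fin in \<open>auto intro: finite_PiE\<close>)
  ultimately show ?thesis
    unfolding g_num_def card_gt_0_iff by blast
qed

text \<open>Glaisher's map splits a part \<open>2 ^ a * m\<close>, \<open>m\<close> odd, into \<open>2 ^ a\<close> copies of \<open>m\<close>; the strict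
  partition is recovered from the binary expansions of the multiplicities.\<close>

definition odd_part :: "nat \<Rightarrow> nat" where
  "odd_part k = k div 2 ^ multiplicity 2 k"

definition glaisher :: "nat list \<Rightarrow> nat multiset" where
  "glaisher l = (\<Sum>k\<in>set l. replicate_mset (2 ^ multiplicity 2 k) (odd_part k))"

lemma odd_part_decompose: "0 < k \<Longrightarrow> 2 ^ multiplicity 2 k * odd_part k = k" "0 < k \<Longrightarrow> odd (odd_part k)"
  by (auto simp: odd_part_def multiplicity_dvd multiplicity_decompose)

lemma multiplicity_two_power_times: "odd m \<Longrightarrow> multiplicity 2 (2 ^ a * m) = (a :: nat)"
  for m :: nat
  by (rule multiplicity_eqI) auto

text \<open>Each part \<open>2 ^ a * m\<close> supplies the binary digit \<open>a\<close> of the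
  multiplicity of \<open>m\<close>, and \<open>set_encode\<close> reads a set as binary
  digits.\<close>

lemma count_glaisher:
  assumes "0 \<notin> set l" "odd m"
  shows "count (glaisher l) m = set_encode {a. 2 ^ a * m \<in> set l}"
proof -
  have m0: "0 < m" using assms(2) by (rule odd_pos)
  have "count (glaisher l) m = (\<Sum>k\<in>set l. if odd_part k = m then 2 ^ multiplicity 2 k else 0)"
    unfolding glaisher_def count_sum by (intro sum.cong) auto
  also have "\<dots> = (\<Sum>k\<in>{k \<in> set l. odd_part k = m}. 2 ^ multiplicity 2 k)"
    by (rule sum.inter_filter[symmetric]) simp
  also have "\<dots> = (\<Sum>a\<in>{a. 2 ^ a * m \<in> set l}. 2 ^ a)"
  proof (rule sum.reindex_bij_witness[of _ "\<lambda>a. 2 ^ a * m" "multiplicity 2"])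
    fix k assume k: "k \<in> {k \<in> set l. odd_part k = m}"
    then have "0 < k" using assms(1) by (auto intro: gr0I)
    then show "2 ^ multiplicity 2 k * m = k" "multiplicity 2 k \<in> {a. 2 ^ a * m \<in> set l}"
      using k odd_part_decompose(1)[of k] by auto
  next
    fix a assume "a \<in> {a. 2 ^ a * m \<in> set l}"
    then show "2 ^ a * m \<in> {k \<in> set l. odd_part k = m}" "multiplicity 2 (2 ^ a * m) = a"
      using multiplicity_two_power_times[OF assms(2), of a] by (auto simp: odd_part_def)
  qed auto
  finally show ?thesis
    by (simp add: set_encode_def)
qed

lemma glaisher_inj:
  assumes "0 \<notin> set l" "0 \<notin> set l'" "glaisher l = glaisher l'"
  shows "set l \<subseteq> set l'"
proof
  fix k assume k: "k \<in> set l"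
  then have k0: "0 < k" using assms(1) by (auto intro: gr0I)
  define m where "m = odd_part k"
  have m: "odd m" "2 ^ multiplicity 2 k * m = k"
    using odd_part_decompose[OF k0] by (auto simp: m_def)
  have fin: "finite {a. 2 ^ a * m \<in> set l}" for l
  proof (rule finite_subset)
    show "{a. 2 ^ a * m \<in> set l} \<subseteq> multiplicity 2 ` set l"
    proof
      fix a assume "a \<in> {a. 2 ^ a * m \<in> set l}"
      then show "a \<in> multiplicity 2 ` set l"
        using multiplicity_two_power_times[OF m(1), of a] by (intro image_eqI[of _ _ "2 ^ a * m"]) auto
    qed
  qed simp
  have "set_encode {a. 2 ^ a * m \<in> set l} = set_encode {a. 2 ^ a * m \<in> set l'}"
    using count_glaisher[OF assms(1) m(1)] count_glaisher[OF assms(2) m(1)] assms(3) by simp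
  then have "{a. 2 ^ a * m \<in> set l} = {a. 2 ^ a * m \<in> set l'}"
    using fin by (simp add: set_encode_eq)
  then show "k \<in> set l'"
    using m(2) k by (metis mem_Collect_eq)
qed

lemma sum_mset_glaisher: "0 \<notin> set l \<Longrightarrow> sum_mset (glaisher l) = \<Sum>(set l)"
proof -
  assume l: "0 \<notin> set l"
  have "sum_mset (\<Sum>k\<in>A. replicate_mset (2 ^ multiplicity 2 k) (odd_part k)) =
      (\<Sum>k\<in>A. 2 ^ multiplicity 2 k * odd_part k)" if "finite A" for A
    using that by induction auto
  then have "sum_mset (glaisher l) = (\<Sum>k\<in>set l. 2 ^ multiplicity 2 k * odd_part k)"
    by (simp add: glaisher_def)
  also have "\<dots> = \<Sum>(set l)"
    using l by (intro sum.cong) (auto intro!: odd_part_decompose gr0I)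
  finally show ?thesis .
qed

text \<open>Injectivity of Glaisher's map. Together with the independence of the functions
  \<open>psi n m\<close> this inequality makes them a basis in \<open>span_psi\<close>.\<close>

lemma card_DP_le_card_OP: "card (DP n) \<le> card (OP n)"
proof (rule card_inj_on_le)
  let ?f = "\<lambda>l. rev (sorted_list_of_multiset (glaisher l))"
  show "inj_on ?f (DP n)"
  proof (rule inj_onI)
    fix l l' assume l: "l \<in> DP n" "l' \<in> DP n" "?f l = ?f l'"
    then have "glaisher l = glaisher l'"
      by (metis mset_sorted_list_of_multiset rev_rev_ident)
    then have "set l = set l'"
      using glaisher_inj[of l l'] glaisher_inj[of l' l] l DP_strict by (metis subset_antisym)
    then show "l = l'"
      using l DP_strict strict_eqI by metis
  qed
  show "?f ` DP n \<subseteq> OP n"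
  proof (intro image_subsetI)
    fix l assume "l \<in> DP n"
    then have l: "sorted_wrt (>) l" "0 \<notin> set l" "sum_list l = n"
      using DP_strict by blast+
    have sub: "set_mset (\<Sum>k\<in>A. replicate_mset (2 ^ multiplicity 2 k) (odd_part k)) \<subseteq> odd_part ` A" if "finite A" for A
      using that by induction (auto split: if_splits)
    have odd: "odd k" if "k \<in># glaisher l" for k
    proof -
      have "k \<in> odd_part ` set l"
        using that sub[of "set l"] unfolding glaisher_def by blast
      then obtain j where "j \<in> set l" "k = odd_part j"
        by blast
      then show ?thesis
        using l(2) odd_part_decompose(2)[of j] by (cases "j = 0") auto
    qed
    have "sum_list (?f l) = sum_mset (mset (?f l))"
      by (simp only: sum_mset_sum_list)
    also have "\<dots> = n"
      using l by (simp add: sum_mset_glaisher sum_list_strict)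
    finally show "?f l \<in> OP n"
      using odd by (auto simp: OP_def partitions_def sorted_wrt_rev dest: odd_pos)
  qed
qed simp

section \<open>The down-up walk\<close>

lemma sum_states_DP:
  "(\<Sum>S\<in>{S \<in> states (int n). Q S}. F S) = (\<Sum>l\<in>DP n. if Q (fset_of_list l) then F (fset_of_list l) else 0)"
  using sum.reindex_bij_betw[OF bij_betw_DP_states, of "\<lambda>S. if Q S then F S else 0" n]
  by (simp add: sum.inter_filter)

lemma fset_of_list_DP_states: "l \<in> DP n \<Longrightarrow> fset_of_list l \<in> states (int n)"
  using bij_betw_DP_states[of n] by (auto simp: bij_betw_def)

lemma OP_odd: "m \<in> OP n \<Longrightarrow> \<forall>j\<in>set m. odd j"
  and OP_sum: "m \<in> OP n \<Longrightarrow> sum_list m = n"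
  and OP_partitions: "m \<in> OP n \<Longrightarrow> m \<in> partitions n"
  by (auto simp: OP_def partitions_def)

definition psi_const :: "nat \<Rightarrow> nat list \<Rightarrow> real" where
  "psi_const n m = sqrt (fact n / (real (z_part m) * 2 ^ (n - length m)))"

definition psi_real :: "nat \<Rightarrow> nat list \<Rightarrow> nat list \<Rightarrow> real" where
  "psi_real n m l = psi_const n m * (fock_vec m (fset_of_list l) / real (g_num l))"

lemma psi_eq:
  assumes "m \<in> OP n"
  shows "psi n m l = (if l \<in> DP n then of_real (psi_real n m l) else 0)"
  using X_coeff_eq[OF OP_odd[OF assms], of l] OP_sum[OF assms]
  by (simp add: psi_def psi_real_def psi_const_def HL_coeff_def)

text \<open>The factor \<open>g_num r\<close> of the walk cancels the denominator of
  \<open>psi_real\<close>. The sum over \<open>r\<close> is then \<open>boson (- 1)\<close> at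
  \<open>t\<close>, and the sum over \<open>t\<close> is \<open>boson 1\<close> at \<open>l\<close>.
  The prefactor \<open>2 / n\<close> meets half the number of ones in \<open>m\<close>.\<close>

lemma down_up_psi_real:
  assumes "n \<ge> 1" "m \<in> OP n" "l \<in> DP n"
  shows "(\<Sum>r\<in>DP n. down_up n l r * psi_real n m r) = real (mult_part 1 m) / real n * psi_real n m l"
proof -
  have n: "int n - 1 = int (n - 1)" using assms(1) by simp
  let ?v = "\<lambda>r. fock_vec m (fset_of_list r)" and ?w = "\<lambda>t r. 2 ^ length t / 2 ^ length r :: real"
  let ?C = "2 * psi_const n m / (real n * real (g_num l))"
  have g: "real (g_num r) \<noteq> 0" for r
    using g_num_pos[of r] by simp
  have summand: "down_up n l r * psi_real n m r = ?C *
      (\<Sum>t\<in>DP (n - 1). if t \<nearrow> l then (if t \<nearrow> r then ?w t r * ?v r else 0) else 0)" for r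
  proof -
    have "(\<Sum>t\<in>{t \<in> DP (n - 1). t \<nearrow> l \<and> t \<nearrow> r}. 2 powi (int (length t) - int (length r)) :: real) * ?v r =
        (\<Sum>t\<in>{t \<in> DP (n - 1). t \<nearrow> l \<and> t \<nearrow> r}. ?w t r * ?v r)"
      by (simp add: power_int_diff sum_distrib_right)
    also have "\<dots> = (\<Sum>t\<in>DP (n - 1). if t \<nearrow> l \<and> t \<nearrow> r then ?w t r * ?v r else 0)"
      by (rule sum.inter_filter) simp
    also have "\<dots> = (\<Sum>t\<in>DP (n - 1). if t \<nearrow> l then (if t \<nearrow> r then ?w t r * ?v r else 0) else 0)"
      by (intro sum.cong) auto
    finally show ?thesis
      using g[of r] by (simp add: down_up_def psi_real_def)
  qed
  have inner: "(\<Sum>r\<in>DP n. if t \<nearrow> r then ?w t r * ?v r else 0) = boson (- 1) (fock_vec m) (fset_of_list t)"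
    if t: "t \<in> DP (n - 1)" for t
  proof -
    have "boson (- 1) (fock_vec m) (fset_of_list t) = (\<Sum>r\<in>DP n. if raises (fset_of_list t) (fset_of_list r) then
        2 ^ fcard (fset_of_list t) / 2 ^ fcard (fset_of_list r) * ?v r else 0)"
      using fset_of_list_DP_states[OF t] by (subst boson_uminus_1[of _ "int n"]) (simp_all only: n sum_states_DP)
    also have "\<dots> = (\<Sum>r\<in>DP n. if t \<nearrow> r then ?w t r * ?v r else 0)"
      using t by (intro sum.cong) (auto simp: fcard_DP covers_iff_raises)
    finally show ?thesis ..
  qed
  have "(\<Sum>r\<in>DP n. down_up n l r * psi_real n m r) =
      ?C * (\<Sum>t\<in>DP (n - 1). \<Sum>r\<in>DP n. if t \<nearrow> l then (if t \<nearrow> r then ?w t r * ?v r else 0) else 0)"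
    unfolding summand sum_distrib_left[symmetric] by (subst sum.swap) (rule refl)
  also have "(\<Sum>t\<in>DP (n - 1). \<Sum>r\<in>DP n. if t \<nearrow> l then (if t \<nearrow> r then ?w t r * ?v r else 0) else 0) =
      (\<Sum>t\<in>DP (n - 1). if raises (fset_of_list t) (fset_of_list l) then boson (- 1) (fock_vec m) (fset_of_list t) else 0)"
  proof (intro sum.cong refl)
    fix t assume t: "t \<in> DP (n - 1)"
    show "(\<Sum>r\<in>DP n. if t \<nearrow> l then (if t \<nearrow> r then ?w t r * ?v r else 0) else 0) =
      (if raises (fset_of_list t) (fset_of_list l) then boson (- 1) (fock_vec m) (fset_of_list t) else 0)"
      unfolding inner[OF t, symmetric] covers_iff_raises[OF t assms(3), symmetric] by simp
  qed
  also have "\<dots> = boson 1 (boson (- 1) (fock_vec m)) (fset_of_list l)"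
    using fset_of_list_DP_states[OF assms(3)] by (subst boson_1[of _ "int n"]) (simp_all only: n sum_states_DP)
  also have "\<dots> = real (mult_part 1 m) / 2 * ?v l"
    by (rule boson_1_boson_uminus_1_fock_vec[OF OP_odd[OF assms(2)]])
  finally show ?thesis
    by (simp add: psi_real_def)
qed

lemma K_op_psi:
  assumes "n \<ge> 1" "m \<in> OP n"
  shows "K_op n (psi n m) = fscale (of_nat (mult_part 1 m) / of_nat n) (psi n m)"
proof
  fix l
  show "K_op n (psi n m) l = fscale (of_nat (mult_part 1 m) / of_nat n) (psi n m) l"
  proof (cases "l \<in> DP n")
    case True
    have "(\<Sum>r\<in>DP n. of_real (down_up n l r) * psi n m r) =
        complex_of_real (\<Sum>r\<in>DP n. down_up n l r * psi_real n m r)"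
      by (simp add: psi_eq[OF assms(2)])
    also have "\<dots> = of_nat (mult_part 1 m) / of_nat n * psi n m l"
      unfolding down_up_psi_real[OF assms True] using True by (simp add: psi_eq[OF assms(2)])
    finally show ?thesis
      using True by (simp add: K_op_def fscale_def)
  qed (simp add: K_op_def fscale_def psi_def)
qed

lemma length_OP: "m \<in> OP n \<Longrightarrow> length m \<le> n"
  using OP_partitions length_partitions by blast

text \<open>The squared \<open>g_num\<close> cancels the denominators, and
  \<open>2 ^ (n - length l)\<close> is \<open>2 ^ n\<close> times the weight in
  \<open>fock_inner\<close>. What remains is \<open>fock_inner_fock_vec\<close>, and the constant in
  \<open>psi\<close> normalises it.\<close>

lemma inner_psi:
  assumes "m \<in> OP n" "m' \<in> OP n"
  shows "inner_DP n (psi n m) (psi n m') = (if m = m' then 1 else 0)"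
proof -
  let ?c = "psi_const n m * psi_const n m' * 2 ^ n / fact n"
  have "inner_DP n (psi n m) (psi n m') = complex_of_real
      (\<Sum>l\<in>DP n. psi_real n m l * psi_real n m' l * (2 ^ (n - length l) * real (g_num l) ^ 2 / fact n))"
    by (simp add: inner_DP_def psi_eq assms)
  also have "(\<Sum>l\<in>DP n. psi_real n m l * psi_real n m' l * (2 ^ (n - length l) * real (g_num l) ^ 2 / fact n)) =
      (\<Sum>l\<in>DP n. ?c * (fock_vec m (fset_of_list l) * fock_vec m' (fset_of_list l) / 2 ^ fcard (fset_of_list l)))"
  proof (intro sum.cong refl)
    fix l assume l: "l \<in> DP n"
    then have "2 ^ (n - length l) = (2 ^ n / 2 ^ length l :: real)"
      by (intro power_diff) (auto simp: DP_def dest: length_partitions)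
    then show "psi_real n m l * psi_real n m' l * (2 ^ (n - length l) * real (g_num l) ^ 2 / fact n) =
        ?c * (fock_vec m (fset_of_list l) * fock_vec m' (fset_of_list l) / 2 ^ fcard (fset_of_list l))"
      using g_num_pos[of l] by (simp add: psi_real_def fcard_DP[OF l] power2_eq_square mult_ac)
  qed
  also have "\<dots> = ?c * fock_inner (int n) (fock_vec m) (fock_vec m')"
    unfolding sum_distrib_left[symmetric] fock_inner_def
    using sum.reindex_bij_betw[OF bij_betw_DP_states, of "\<lambda>S. fock_vec m S * fock_vec m' S / 2 ^ fcard S" n] by simp
  also have "\<dots> = (if m = m' then 1 else 0)"
  proof -
    have "mset m = mset m' \<longleftrightarrow> m = m'"
      using partitions_mset_eqD OP_partitions assms by blast
    then have fock_inner: "fock_inner (int n) (fock_vec m) (fock_vec m') = (if m = m' then real (z_part m) / 2 ^ length m else 0)"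
      using fock_inner_fock_vec[OF OP_odd[OF assms(1)] OP_odd[OF assms(2)]] OP_sum[OF assms(1)] by simp
    have z: "0 < z_part m"
      using OP_partitions[OF assms(1)] by (intro z_part_pos) (simp add: partitions_def)
    have "(2 :: real) ^ n = 2 ^ (n - length m) * 2 ^ length m"
      using length_OP[OF assms(1)] by (simp flip: power_add)
    moreover have "psi_const n m * psi_const n m = fact n / (real (z_part m) * 2 ^ (n - length m))"
      unfolding psi_const_def by (rule real_sqrt_mult_self[THEN trans]) simp
    ultimately have "psi_const n m * psi_const n m * 2 ^ n / fact n * (real (z_part m) / 2 ^ length m) = 1"
      using z by simp
    then show ?thesis
      using fock_inner by (cases "m = m'") (simp_all only: if_True if_False refl mult_zero_right)
  qed
  finally show ?thesis by simp
qed

section \<open>Basis property and eigenspaces\<close>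

lemma sum_fun_apply: "(\<Sum>x\<in>X. f x) l = (\<Sum>x\<in>X. f x l)"
  by (induction X rule: infinite_finite_induct) auto

lemma inner_DP_sum:
  "inner_DP n (\<Sum>x\<in>X. fscale (a x) (f x)) g = (\<Sum>x\<in>X. a x * inner_DP n (f x) g)"
  unfolding inner_DP_def sum_fun_apply sum_distrib_left sum_distrib_right fscale_def
  by (subst sum.swap) (simp add: mult_ac)

lemma inner_DP_sum_psi:
  assumes "m \<in> OP n"
  shows "inner_DP n (\<Sum>x\<in>OP n. fscale (a x) (psi n x)) (psi n m) = a m"
  unfolding inner_DP_sum using assms by (simp add: inner_psi if_distrib[of "\<lambda>y. _ * y"] cong: if_cong)

lemma inj_on_psi: "inj_on (psi n) (OP n)"
proof (rule inj_onI, rule ccontr)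
  fix m m' assume m: "m \<in> OP n" "m' \<in> OP n" "psi n m = psi n m'" "m \<noteq> m'"
  show False
    using inner_psi[OF m(1,2)] inner_psi[OF m(2,2)] m(3,4) by simp
qed

text \<open>Orthonormality: pairing a vanishing combination with \<open>psi n m\<close> isolates the
  coefficient of \<open>m\<close>.\<close>

lemma independent_psi: "fn.independent (psi n ` OP n)"
proof
  assume "fn.dependent (psi n ` OP n)"
  then obtain u where u: "\<exists>v\<in>psi n ` OP n. u v \<noteq> 0" "(\<Sum>v\<in>psi n ` OP n. fscale (u v) v) = 0"
    using fn.dependent_finite[of "psi n ` OP n"] by auto
  have sum0: "(\<Sum>m\<in>OP n. fscale (u (psi n m)) (psi n m)) = 0"
    using u(2) unfolding sum.reindex[OF inj_on_psi] by simp
  have "u (psi n m) = 0" if "m \<in> OP n" for m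
    using inner_DP_sum_psi[OF that, of "\<lambda>m. u (psi n m)"] unfolding sum0
    by (simp add: inner_DP_def)
  then show False
    using u(1) by auto
qed

lemma fun_space_span:
  "f \<in> fun_space n \<Longrightarrow> f \<in> fn.span ((\<lambda>l k. if k = l then 1 else 0) ` DP n)"
proof -
  assume f: "f \<in> fun_space n"
  have "f = (\<Sum>l\<in>DP n. fscale (f l) (\<lambda>k. if k = l then 1 else 0))"
  proof
    fix k
    have "(\<Sum>l\<in>DP n. fscale (f l) (\<lambda>k. if k = l then 1 else 0)) k = (\<Sum>l\<in>DP n. if k = l then f l else 0)"
      unfolding sum_fun_apply fscale_def by (intro sum.cong) auto
    then show "f k = (\<Sum>l\<in>DP n. fscale (f l) (\<lambda>k. if k = l then 1 else 0)) k"
      using f by (auto simp: fun_space_def)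
  qed
  moreover have "(\<Sum>l\<in>DP n. fscale (f l) (\<lambda>k. if k = l then 1 else 0))
      \<in> fn.span ((\<lambda>l k. if k = l then 1 else 0) ` DP n)"
    by (intro fn.span_sum fn.span_scale fn.span_base) auto
  ultimately show ?thesis by simp
qed

lemma subspace_fun_space: "fn.subspace (fun_space n)"
  by (auto simp: fn.subspace_def fun_space_def fscale_def)

lemma psi_fun_space: "psi n m \<in> fun_space n"
  by (simp add: fun_space_def psi_def)

text \<open>A function outside the span would enlarge the independent family beyond
  \<open>card (OP n)\<close>, which is at least \<open>card (DP n)\<close>. But
  \<open>fun_space n\<close> lies in the span of the \<open>card (DP n)\<close> indicator
  functions.\<close>

lemma span_psi: "fn.span (psi n ` OP n) = fun_space n"
proof
  show "fn.span (psi n ` OP n) \<subseteq> fun_space n"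
    using psi_fun_space subspace_fun_space by (intro fn.span_minimal) auto
  show "fun_space n \<subseteq> fn.span (psi n ` OP n)"
  proof (rule subsetI, rule ccontr)
    fix f assume f: "f \<in> fun_space n" "f \<notin> fn.span (psi n ` OP n)"
    let ?E = "(\<lambda>l k. if k = l then 1 else 0 :: complex) ` DP n"
    have "fn.independent (insert f (psi n ` OP n))"
      using f independent_psi by (simp add: fn.independent_insert)
    moreover have "insert f (psi n ` OP n) \<subseteq> fn.span ?E"
      using f psi_fun_space fun_space_span by blast
    ultimately have "card (insert f (psi n ` OP n)) \<le> card ?E"
      using fn.independent_span_bound[of ?E "insert f (psi n ` OP n)"] by simp
    also have "\<dots> \<le> card (DP n)"
      by (rule card_image_le) simp
    also have "\<dots> \<le> card (OP n)"
      by (rule card_DP_le_card_OP)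
    also have "\<dots> = card (psi n ` OP n)"
      using card_image[OF inj_on_psi] by simp
    finally show False
      using f(2) fn.span_base[of f "psi n ` OP n"] by (simp add: card_insert_if split: if_splits)
  qed
qed

lemma psi_expansion:
  assumes "f \<in> fun_space n"
  obtains a where "f = (\<Sum>m\<in>OP n. fscale (a m) (psi n m))"
proof -
  have "f \<in> fn.span (psi n ` OP n)"
    using assms by (simp add: span_psi)
  then obtain u where "f = (\<Sum>v\<in>psi n ` OP n. fscale (u v) v)"
    using fn.span_finite[of "psi n ` OP n"] by auto
  then have "f = (\<Sum>m\<in>OP n. fscale (u (psi n m)) (psi n m))"
    unfolding sum.reindex[OF inj_on_psi] by simp
  then show ?thesis
    by (rule that)
qed

lemma K_op_sum: "K_op n (\<Sum>x\<in>X. fscale (a x) (f x)) = (\<Sum>x\<in>X. fscale (a x) (K_op n (f x)))"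
proof
  fix l
  have "(\<Sum>r\<in>DP n. of_real (down_up n l r) * (\<Sum>x\<in>X. a x * f x r)) =
      (\<Sum>x\<in>X. a x * (\<Sum>r\<in>DP n. of_real (down_up n l r) * f x r))"
    unfolding sum_distrib_left by (subst sum.swap) (simp add: mult_ac)
  then show "K_op n (\<Sum>x\<in>X. fscale (a x) (f x)) l = (\<Sum>x\<in>X. fscale (a x) (K_op n (f x))) l"
    by (simp add: K_op_def sum_fun_apply fscale_def)
qed

lemma K_op_zero: "K_op n 0 = 0"
  and K_op_add: "K_op n (f + g) = K_op n f + K_op n g"
  and K_op_scale: "K_op n (fscale a f) = fscale a (K_op n f)"
  by (auto simp: K_op_def fscale_def fun_eq_iff algebra_simps sum.distrib sum_distrib_left)

text \<open>Expanding an eigenvector in the basis \<open>psi\<close> and comparing coefficients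
  leaves only those \<open>m\<close> whose eigenvalue is \<open>c\<close>.\<close>

lemma eigenspace_psi:
  assumes "n \<ge> 1"
  shows "eigenspace n c = fn.span (psi n ` {m \<in> OP n. of_nat (mult_part 1 m) / of_nat n = c})"
    (is "_ = fn.span (psi n ` ?M)")
proof
  let ?e = "\<lambda>m. of_nat (mult_part 1 m) / of_nat n :: complex"
  show "eigenspace n c \<subseteq> fn.span (psi n ` ?M)"
  proof
    fix f assume f: "f \<in> eigenspace n c"
    then obtain a where a: "f = (\<Sum>m\<in>OP n. fscale (a m) (psi n m))"
      using psi_expansion by (auto simp: eigenspace_def)
    have "K_op n f = (\<Sum>m\<in>OP n. fscale (a m * ?e m) (psi n m))"
      unfolding a K_op_sum using assms by (intro sum.cong refl) (simp add: K_op_psi fscale_def mult.assoc)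
    moreover have "K_op n f = (\<Sum>m\<in>OP n. fscale (c * a m) (psi n m))"
      using f unfolding eigenspace_def a
      by (simp add: fn.scale_sum_right)
    ultimately have eq: "(\<Sum>m\<in>OP n. fscale (a m * ?e m) (psi n m)) = (\<Sum>m\<in>OP n. fscale (c * a m) (psi n m))"
      by simp
    have a0: "a m = 0" if "m \<in> OP n" "?e m \<noteq> c" for m
    proof -
      have "a m * ?e m = c * a m"
        using inner_DP_sum_psi[OF that(1), of "\<lambda>m. a m * ?e m"] inner_DP_sum_psi[OF that(1), of "\<lambda>m. c * a m"]
        unfolding eq by simp
      then have "a m * (?e m - c) = 0"
        by (simp only: right_diff_distrib mult.commute[of c] diff_self)
      then show ?thesis
        using that(2) by simp
    qed
    have "f = (\<Sum>m\<in>?M. fscale (a m) (psi n m))"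
      unfolding a by (rule sum.mono_neutral_right) (auto simp: a0)
    moreover have "(\<Sum>m\<in>?M. fscale (a m) (psi n m)) \<in> fn.span (psi n ` ?M)"
      by (intro fn.span_sum fn.span_scale fn.span_base imageI)
    ultimately show "f \<in> fn.span (psi n ` ?M)"
      by (simp only:)
  qed
  show "fn.span (psi n ` ?M) \<subseteq> eigenspace n c"
  proof (rule fn.span_minimal)
    show "psi n ` ?M \<subseteq> eigenspace n c"
      using K_op_psi[OF assms] psi_fun_space by (auto simp: eigenspace_def)
    show "fn.subspace (eigenspace n c)"
    proof (rule fn.subspaceI)
      show "0 \<in> eigenspace n c"
        using subspace_fun_space[of n] by (simp add: eigenspace_def K_op_zero fn.subspace_0)
      show "f + g \<in> eigenspace n c" if "f \<in> eigenspace n c" "g \<in> eigenspace n c" for f g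
        using that subspace_fun_space[of n]
        by (simp add: eigenspace_def K_op_add fn.subspace_add fn.scale_right_distrib)
      show "fscale a f \<in> eigenspace n c" if "f \<in> eigenspace n c" for a f
        using that subspace_fun_space[of n]
        by (simp add: eigenspace_def K_op_scale fn.subspace_scale fn.scale_left_commute)
    qed
  qed
qed

theorem proposition6p3:
  fixes n :: nat
  assumes "n \<ge> 1"
  shows
    "\<comment> \<open>(1), with multiplicities\<close>
     {c. is_eigenvalue n c} = (\<lambda>m. of_nat (mult_part 1 m) / of_nat n) ` OP n \<and>
     (\<forall>c. fn.dim (eigenspace n c) =
        card {m \<in> OP n. of_nat (mult_part 1 m) / of_nat n = c}) \<and>
     \<comment> \<open>(2)\<close>
     (\<forall>m\<in>OP n. is_eigenvector n (of_nat (mult_part 1 m) / of_nat n) (psi n m)) \<and>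
     inj_on (psi n) (OP n) \<and>
     fn.independent (psi n ` OP n) \<and>
     fn.span (psi n ` OP n) = fun_space n \<and>
     (\<forall>m\<in>OP n. \<forall>m'\<in>OP n. inner_DP n (psi n m) (psi n m') = (if m = m' then 1 else 0))"
proof -
  let ?e = "\<lambda>m. of_nat (mult_part 1 m) / of_nat n :: complex"
  have vector: "is_eigenvector n (?e m) (psi n m)" if "m \<in> OP n" for m
  proof -
    have "psi n m \<noteq> 0"
      using inner_psi[OF that that] by (auto simp: inner_DP_def)
    then show ?thesis
      using that K_op_psi[OF assms] psi_fun_space by (simp add: is_eigenvector_def eigenspace_def)
  qed
  have "c \<in> ?e ` OP n" if "is_eigenvalue n c" for c
  proof (rule ccontr)
    assume "c \<notin> ?e ` OP n"
    then have "{m \<in> OP n. ?e m = c} = {}"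
      by auto
    then have "eigenspace n c = {0}"
      unfolding eigenspace_psi[OF assms] by (simp only: image_empty fn.span_empty)
    then show False
      using that by (auto simp: is_eigenvalue_def is_eigenvector_def)
  qed
  then have eigenvalues: "{c. is_eigenvalue n c} = ?e ` OP n"
    using vector by (auto simp: is_eigenvalue_def)
  have "fn.dim (eigenspace n c) = card {m \<in> OP n. ?e m = c}" for c
  proof -
    have "fn.independent (psi n ` {m \<in> OP n. ?e m = c})"
      by (rule fn.independent_mono[OF independent_psi]) auto
    then have "fn.dim (eigenspace n c) = card (psi n ` {m \<in> OP n. ?e m = c})"
      unfolding eigenspace_psi[OF assms] by (rule fn.dim_span_eq_card_independent)
    also have "\<dots> = card {m \<in> OP n. ?e m = c}"
      by (rule card_image) (rule inj_on_subset[OF inj_on_psi], auto)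
    finally show ?thesis .
  qed
  then show ?thesis
    using vector eigenvalues inj_on_psi independent_psi span_psi inner_psi by blast
qed

end
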